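(* Suppose there is an $i\in E$ such that $a(i)>0$, and let $\delta>0$. Then there is a unique $s\in(0,s_1)$ such that $\rho(M_s)=1$, and this $s$ equals the unique $\kappa>0$ such that $\rho(A_{(\kappa,\delta)})=1$.
   Context: Let $E=\{1,\dots,N\}$ with $N>1$. Let $X=(X_t)_{t\ge 0}$ be a Markov jump process with state space $E$, with positive intensity function $\lambda:E\to(0,\infty)$ and jump kernel $q$ (a stochastic matrix on $E$) which is irreducible and satisfies $q(i,i)=0$ for every $i\in E$: in state $i$ the process waits an exponential time with parameter $\lambda(i)$ and then jumps to $j$ with probability $q(i,j)$. Let $\mu$ be its invariant probability measure; $X$ is taken stationary. Let $a:E\to\mathbb{R}$. Standing assumption: $\sum_{i\in E}a(i)\mu(i)<0$. $\mathbb{E}_i$ denotes expectation conditionally on $X_0=i$, and $\rho$ denotes the spectral radius of a matrix. For $\delta>0$ set $\Phi_1(\delta)=\exp\int_0^{\delta}a(X_u)\,du$, and for $s\ge0$ let $A_{(s,\delta)}$ be the operator on functions $\varphi:E\to\mathbb{R}$ given by $A_{(s,\delta)}\varphi(i)=\mathbb{E}_i[\Phi_1(\delta)^s\varphi(X_\delta)]$, i.e. the $N\times N$ matrix with entries $\mathbb{E}_i[\Phi_1(\delta)^s\mathbf{1}_{X_\delta=j}]$. (When some $a(i)>0$, there is a unique $\kappa>0$ with $\rho(A_{(\kappa,\delta)})=1$, and it does not depend on $\delta$.) Set $s_1=\min\{\lambda(i)/a(i) : i\in E,\ a(i)>0\}$, and for $0\le s<s_1$ let $M_s$ be the $N\times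 N$ matrix $$M_s=\Big(q(i,j)\frac{\lambda(i)}{\lambda(i)-s\,a(i)}\Big)_{i,j\in E}.$$ *)

theory Defs
  imports "HOL-Probability.Probability"
begin

text \<open>
  The state space is a finite type \<open>'n\<close>; matrices indexed by it are elements of
  \<open>real ^ 'n ^ 'n\<close>, with row index first.
\<close>

definition eigenvalues :: "real ^ 'n ^ 'n \<Rightarrow> complex set" where
  "eigenvalues A = {z. \<exists>v :: complex ^ 'n. v \<noteq> 0 \<and> map_matrix complex_of_real A *v v = z *s v}"

text \<open>The set of eigenvalues is finite and nonempty, so the supremum is a maximum.\<close>

definition spectral_radius :: "real ^ 'n ^ 'n \<Rightarrow> real" where
  "spectral_radius A = Sup (norm ` eigenvalues A)"

definition stochastic_matrix :: "real ^ 'n ^ 'n \<Rightarrow> bool" where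
  "stochastic_matrix q \<longleftrightarrow> (\<forall>i j. 0 \<le> q $ i $ j) \<and> (\<forall>i. (\<Sum>j\<in>UNIV. q $ i $ j) = 1)"

text \<open>Every state leads to every other one through transitions of positive probability.\<close>

definition irreducible_matrix :: "real ^ 'n ^ 'n \<Rightarrow> bool" where
  "irreducible_matrix q \<longleftrightarrow> (\<forall>i j. (i, j) \<in> {(k, l). 0 < q $ k $ l}\<^sup>*)"

text \<open>
  \<open>Y\<close> is the jump chain and \<open>S n\<close> the holding time between the \<open>n\<close>-th and the next jump.
  The last clause says that \<open>Y\<close> is a Markov chain with kernel \<open>q\<close> and that, given \<open>Y\<close>, the
  holding times are independent, \<open>S k\<close> being exponential with parameter \<open>lam (Y k)\<close>; it leaves
  the initial distribution free.  All paths are step functions on \<open>[0, \<infinity>)\<close> with finitely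
  many jumps in bounded intervals; for negative times \<open>X\<close> is unconstrained.
\<close>

definition markov_jump_process ::
  "'w measure \<Rightarrow> ('n::finite \<Rightarrow> real) \<Rightarrow> real ^ 'n ^ 'n \<Rightarrow> (real \<Rightarrow> 'w \<Rightarrow> 'n) \<Rightarrow> bool" where
  "markov_jump_process M lam q X \<longleftrightarrow> prob_space M \<and>
    (\<exists>(Y :: nat \<Rightarrow> 'w \<Rightarrow> 'n) (S :: nat \<Rightarrow> 'w \<Rightarrow> real).
      (\<forall>n. Y n \<in> M \<rightarrow>\<^sub>M count_space UNIV) \<and>
      (\<forall>n. S n \<in> borel_measurable M) \<and>
      (\<forall>\<omega>\<in>space M. \<forall>n. 0 < S n \<omega>) \<and>
      (\<forall>\<omega>\<in>space M. \<forall>t\<ge>0. \<exists>n.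
          (\<Sum>k<n. S k \<omega>) \<le> t \<and> t < (\<Sum>k<Suc n. S k \<omega>) \<and> X t \<omega> = Y n \<omega>) \<and>
      (\<forall>n (i :: nat \<Rightarrow> 'n) (t :: nat \<Rightarrow> real). (\<forall>k. 0 \<le> t k) \<longrightarrow>
          measure M {\<omega>\<in>space M. \<forall>k\<le>n. Y k \<omega> = i k \<and> t k < S k \<omega>} =
          measure M {\<omega>\<in>space M. Y 0 \<omega> = i 0} *
          (\<Prod>k<n. q $ i k $ i (Suc k)) * (\<Prod>k\<le>n. exp (- lam (i k) * t k))))"

text \<open>Invariance of the finite-dimensional distributions under time shifts.\<close>

definition stationary_process :: "'w measure \<Rightarrow> (real \<Rightarrow> 'w \<Rightarrow> 'n) \<Rightarrow> bool" where
  "stationary_process M X \<longleftrightarrow>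
    (\<forall>h\<ge>0. \<forall>T. finite T \<and> T \<subseteq> {0..} \<longrightarrow> (\<forall>f.
      measure M {\<omega>\<in>space M. \<forall>t\<in>T. X (t + h) \<omega> = f t} =
      measure M {\<omega>\<in>space M. \<forall>t\<in>T. X t \<omega> = f t}))"

definition generator :: "('n \<Rightarrow> real) \<Rightarrow> real ^ 'n ^ 'n \<Rightarrow> real ^ 'n ^ 'n" where
  "generator lam q = (\<chi> i j. lam i * (q $ i $ j - (if i = j then 1 else 0)))"

definition invariant_probability ::
  "('n::finite \<Rightarrow> real) \<Rightarrow> real ^ 'n ^ 'n \<Rightarrow> ('n \<Rightarrow> real) \<Rightarrow> bool" where
  "invariant_probability lam q \<mu> \<longleftrightarrow>
    (\<forall>i. 0 \<le> \<mu> i) \<and> (\<Sum>i\<in>UNIV. \<mu> i) = 1 \<and>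
    (\<forall>j. (\<Sum>i\<in>UNIV. \<mu> i * generator lam q $ i $ j) = 0)"

definition expect_from ::
  "'w measure \<Rightarrow> (real \<Rightarrow> 'w \<Rightarrow> 'n) \<Rightarrow> 'n \<Rightarrow> ('w \<Rightarrow> real) \<Rightarrow> real" where
  "expect_from M X i Z = (\<integral>\<omega>. Z \<omega> \<partial>(uniform_measure M {\<omega>\<in>space M. X 0 \<omega> = i}))"

definition Phi1 :: "(real \<Rightarrow> 'w \<Rightarrow> 'n) \<Rightarrow> ('n \<Rightarrow> real) \<Rightarrow> real \<Rightarrow> 'w \<Rightarrow> real" where
  "Phi1 X a \<delta> \<omega> = exp (LBINT u:{0..\<delta>}. a (X u \<omega>))"

definition A_matrix ::
  "'w measure \<Rightarrow> (real \<Rightarrow> 'w \<Rightarrow> 'n) \<Rightarrow> ('n \<Rightarrow> real) \<Rightarrow> real \<Rightarrow> real \<Rightarrow> real ^ 'n ^ 'n" where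
  "A_matrix M X a s \<delta> =
    (\<chi> i j. expect_from M X i (\<lambda>\<omega>. Phi1 X a \<delta> \<omega> powr s * (if X \<delta> \<omega> = j then 1 else 0)))"

definition s1 :: "('n::finite \<Rightarrow> real) \<Rightarrow> ('n \<Rightarrow> real) \<Rightarrow> real" where
  "s1 lam a = Min {lam i / a i | i. a i > 0}"

definition M_matrix ::
  "('n \<Rightarrow> real) \<Rightarrow> real ^ 'n ^ 'n \<Rightarrow> ('n \<Rightarrow> real) \<Rightarrow> real \<Rightarrow> real ^ 'n ^ 'n" where
  "M_matrix lam q a s = (\<chi> i j. q $ i $ j * (lam i / (lam i - s * a i)))"

end

theory Submission
  imports Defs
begin

text \<open>
  Write \<open>G\<close> for the generator of the process and \<open>\<Lambda>(s)\<close> for the principal eigenvalue of the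
  tilted generator \<open>G + s diag(a)\<close>, the eigenvalue that belongs to a positive eigenvector
  (\<open>positive_eigenvector_exists\<close>).  Both spectral conditions of the theorem are the equation
  \<open>\<Lambda>(s) = 0\<close> in disguise.

  For the jump chain matrix this is algebra: multiplying the row \<open>i\<close> of \<open>M\<^sub>s v = v\<close> by
  \<open>lam i - s * a i\<close> turns it into \<open>(G + s diag(a)) v = 0\<close>, and a positive solution of the latter can
  only exist if all these factors are positive, that is, if \<open>s < s1\<close>
  (\<open>M_matrix_radius_one_iff\<close>).

  For \<open>A_matrix\<close> it is the Feynman-Kac formula: the operator is \<open>exp (\<delta> (G + s diag(a)))\<close>, so
  its spectral radius is \<open>exp (\<delta> \<Lambda>(s))\<close> (\<open>A_matrix_spectral_radius\<close>).  Only the action on the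
  positive eigenvector is needed.  It comes from a martingale argument over the successive jumps
  (\<open>feynman_kac\<close>), whose single step is an integral over one exponential holding time
  (\<open>exponential_law_one_step\<close>); the holding times along a path of the jump chain are independent
  exponential variables (\<open>holding_times_law\<close>).

  Finally \<open>\<Lambda>\<close> has exactly one positive zero (\<open>growth_rate_unique_zero\<close>).  It is convex, because
  geometric means of eigenvectors are supersolutions; \<open>\<Lambda>(0) = 0\<close>; its slope at \<open>0\<close> is
  the stationary mean of \<open>a\<close>, which is negative; and \<open>\<Lambda>(s) \<ge> s * a i - lam i\<close> tends to infinity
  because some \<open>a i\<close> is positive.
\<close>

section \<open>Positive eigenvectors\<close>

lemma matrix_vector_component:
  "(A *v v) $ i = (\<Sum>j\<in>UNIV. A $ i $ j * v $ j)"
  by (simp add: matrix_vector_mult_def)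

lemma sum_split_diagonal:
  fixes f :: "'n::finite \<Rightarrow> real"
  shows "(\<Sum>j\<in>UNIV. f j) = f i + (\<Sum>j\<in>UNIV - {i}. f j)"
  by (rule sum.remove) auto

lemma exists_maximal_ratio:
  fixes f g :: "'n::finite \<Rightarrow> real"
  assumes g: "\<And>i. 0 < g i"
  obtains i c where "f i = c * g i" and "\<And>j. f j \<le> c * g j"
proof -
  define c where "c = Max (range (\<lambda>i. f i / g i))"
  have "c \<in> range (\<lambda>i. f i / g i)"
    unfolding c_def by (rule Max_in) auto
  then obtain i where "c = f i / g i" by auto
  then have "f i = c * g i" using g[of i] by simp
  moreover have "f j \<le> c * g j" for j
  proof -
    have "f j / g j \<le> c" unfolding c_def by (rule Max_ge) auto
    then show ?thesis using g[of j] by (simp add: divide_le_eq)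
  qed
  ultimately show ?thesis by (rule that)
qed

text \<open>
  For the norm \<open>max |w i| / v i\<close> weighted by a positive eigenvector \<open>v\<close>, the operator norm of
  \<open>A\<close> is \<open>r\<close>, so no eigenvalue has modulus above \<open>r\<close>.  This is how every spectral
  radius below is computed: it suffices to exhibit a positive eigenvector.
\<close>

lemma spectral_radius_eq_positive_eigenvalue:
  fixes A :: "real ^ 'n::finite ^ 'n"
  assumes nonneg: "\<And>i j. 0 \<le> A $ i $ j"
    and pos: "\<And>i. 0 < v $ i"
    and eigen: "A *v v = r *s v"
  shows "spectral_radius A = r"
  unfolding spectral_radius_def
proof (rule cSup_eq_maximum)
  have Av: "(\<Sum>j\<in>UNIV. A $ i $ j * v $ j) = r * v $ i" for i
    using arg_cong[OF eigen, of "\<lambda>x. x $ i"] by (simp add: matrix_vector_component)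
  have "0 \<le> r * v $ i" for i
    unfolding Av[symmetric] using nonneg pos by (simp add: sum_nonneg less_imp_le)
  then have r: "0 \<le> r"
    using pos by (meson linorder_not_le mult_neg_pos)
  define w :: "complex ^ 'n" where "w = (\<chi> i. complex_of_real (v $ i))"
  have "map_matrix complex_of_real A *v w = complex_of_real r *s w"
    by (simp add: vec_eq_iff matrix_vector_mult_def map_matrix_def w_def Av
        flip: of_real_mult of_real_sum)
  moreover have "w \<noteq> 0"
    using pos by (auto simp: vec_eq_iff w_def less_le)
  ultimately have "complex_of_real r \<in> eigenvalues A"
    by (auto simp: eigenvalues_def)
  then show "r \<in> norm ` eigenvalues A"
    using r by (metis imageI norm_of_real abs_of_nonneg)
next
  fix x assume "x \<in> norm ` eigenvalues A"
  then obtain z w where x: "x = norm z" and w: "w \<noteq> 0"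
    and zw: "map_matrix complex_of_real A *v w = z *s w"
    by (auto simp: eigenvalues_def)
  have Av: "(\<Sum>j\<in>UNIV. A $ i $ j * v $ j) = r * v $ i" for i
    using arg_cong[OF eigen, of "\<lambda>x. x $ i"] by (simp add: matrix_vector_component)
  obtain i c where c: "norm (w $ i) = c * v $ i" "\<And>j. norm (w $ j) \<le> c * v $ j"
    using exists_maximal_ratio[of "\<lambda>i. v $ i" "\<lambda>i. norm (w $ i)"] pos by metis
  obtain j where "w $ j \<noteq> 0" using w by (auto simp: vec_eq_iff)
  then have "0 < c * v $ j" using c(2)[of j] by (smt (verit) zero_less_norm_iff)
  then have "0 < c" using pos[of j] by (simp add: zero_less_mult_iff)
  have "norm z * norm (w $ i) = norm (\<Sum>j\<in>UNIV. complex_of_real (A $ i $ j) * w $ j)"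
    using arg_cong[OF zw, of "\<lambda>x. x $ i"]
    by (simp add: matrix_vector_mult_def map_matrix_def norm_mult)
  also have "\<dots> \<le> (\<Sum>j\<in>UNIV. A $ i $ j * norm (w $ j))"
    by (rule order_trans[OF norm_sum]) (simp add: norm_mult nonneg)
  also have "\<dots> \<le> (\<Sum>j\<in>UNIV. A $ i $ j * (c * v $ j))"
    by (intro sum_mono mult_left_mono c nonneg)
  also have "\<dots> = c * (r * v $ i)"
    unfolding Av[symmetric] by (simp add: sum_distrib_left mult_ac)
  also have "\<dots> = r * norm (w $ i)" using c by simp
  finally show "x \<le> r"
    using x c(1) \<open>0 < c\<close> pos[of i] by simp
qed

lemma irreducible_matrix_induct:
  assumes "irreducible_matrix B" and "P i"
    and "\<And>k l. P k \<Longrightarrow> 0 < B $ k $ l \<Longrightarrow> P l"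
  shows "P j"
proof -
  have "(i, j) \<in> {(k, l). 0 < B $ k $ l}\<^sup>*"
    using assms(1) by (simp add: irreducible_matrix_def)
  then show ?thesis
    by (induction rule: rtrancl_induct) (use assms in auto)
qed

lemma irreducible_matrix_mono:
  assumes "irreducible_matrix q" and "\<And>k l. 0 < q $ k $ l \<Longrightarrow> 0 < B $ k $ l"
  shows "irreducible_matrix B"
proof -
  have "{(k, l). 0 < q $ k $ l}\<^sup>* \<subseteq> {(k, l). 0 < B $ k $ l}\<^sup>*"
    by (rule rtrancl_mono) (use assms in auto)
  then show ?thesis using assms(1) by (auto simp: irreducible_matrix_def)
qed

text \<open>
  The Perron-Frobenius theorem for matrices whose negative entries lie on the diagonal.  Adding
  a large multiple \<open>c\<close> of the identity makes \<open>F v = B v + c v\<close> dominate \<open>v\<close> on the simplex, so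
  normalising \<open>F v\<close> gives a continuous map of the simplex to itself; a fixed point by Brouwer is
  a nonnegative eigenvector.  Its zero set is closed under the transitions of \<open>B\<close>, so
  irreducibility makes it positive.
\<close>

lemma positive_eigenvector_exists:
  fixes B :: "real ^ 'n::finite ^ 'n"
  assumes off: "\<And>i j. i \<noteq> j \<Longrightarrow> 0 \<le> B $ i $ j"
    and irr: "irreducible_matrix B"
  shows "\<exists>r v. (\<forall>i. 0 < v $ i) \<and> B *v v = r *s v"
proof -
  define c where "c = Max (range (\<lambda>i. 1 + \<bar>B $ i $ i\<bar>))"
  have c: "1 - B $ i $ i \<le> c" for i
  proof -
    have "1 + \<bar>B $ i $ i\<bar> \<le> c" unfolding c_def by (rule Max_ge) auto
    then show ?thesis by linarith
  qed
  define F :: "real ^ 'n \<Rightarrow> real ^ 'n" where "F v = B *v v + c *s v" for v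
  define K :: "(real ^ 'n) set" where "K = {v. (\<forall>i. 0 \<le> v $ i) \<and> (\<Sum>i\<in>UNIV. v $ i) = 1}"
  define f where "f v = (1 / (\<Sum>i\<in>UNIV. F v $ i)) *\<^sub>R F v" for v
  have F_ge: "v $ i \<le> F v $ i" if "v \<in> K" for v i
  proof -
    have "0 \<le> (\<Sum>j\<in>UNIV - {i}. B $ i $ j * v $ j)"
      using that off by (intro sum_nonneg mult_nonneg_nonneg) (auto simp: K_def)
    moreover have "(1 - B $ i $ i) * v $ i \<le> c * v $ i"
      using that c by (intro mult_right_mono) (auto simp: K_def)
    ultimately show ?thesis
      by (simp add: F_def matrix_vector_component sum_split_diagonal[of _ i] algebra_simps)
  qed
  have F_sum: "1 \<le> (\<Sum>i\<in>UNIV. F v $ i)" if "v \<in> K" for v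
    using sum_mono[of UNIV "\<lambda>i. v $ i" "\<lambda>i. F v $ i"] F_ge[OF that] that by (simp add: K_def)
  have "compact K"
  proof (rule compact_eq_bounded_closed[THEN iffD2, OF conjI])
    have "norm v \<le> 1" if "v \<in> K" for v
      using norm_le_l1_cart[of v] that by (simp add: K_def)
    then show "bounded K" by (auto simp: bounded_iff)
    have "K = (\<Inter>i. {v. 0 \<le> v $ i}) \<inter> {v. (\<Sum>i\<in>UNIV. v $ i) = 1}"
      by (auto simp: K_def)
    then show "closed K"
      by (auto intro!: closed_Int closed_INT closed_Collect_le closed_Collect_eq continuous_intros)
  qed
  moreover have "convex K"
    by (auto simp: convex_def K_def sum.distrib simp flip: sum_distrib_left)
  moreover have "K \<noteq> {}"
  proof -
    have "(\<chi> i. 1 / real CARD('n)) \<in> K" by (simp add: K_def)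
    then show ?thesis by auto
  qed
  moreover have "continuous_on K f"
  proof -
    have "F = (\<lambda>v. \<chi> i. (\<Sum>j\<in>UNIV. B $ i $ j * v $ j) + c * v $ i)"
      by (simp add: F_def fun_eq_iff vec_eq_iff matrix_vector_component)
    then have "continuous_on K F" by (auto intro!: continuous_intros)
    moreover have "(\<Sum>i\<in>UNIV. F v $ i) \<noteq> 0" if "v \<in> K" for v
      using F_sum[OF that] by simp
    ultimately show ?thesis unfolding f_def by (auto intro!: continuous_intros)
  qed
  moreover have "f \<in> K \<rightarrow> K"
  proof
    fix v assume v: "v \<in> K"
    have "0 \<le> F v $ i" for i
      using F_ge[OF v, of i] v by (auto simp: K_def intro: order_trans)
    then show "f v \<in> K"
      using F_sum[OF v] by (auto simp: f_def K_def simp flip: sum_divide_distrib)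
  qed
  ultimately obtain v where v: "v \<in> K" "f v = v"
    using brouwer[of K f] by blast
  define r where "r = (\<Sum>i\<in>UNIV. F v $ i) - c"
  have "F v = (r + c) *\<^sub>R v"
  proof -
    have "(\<Sum>i\<in>UNIV. F v $ i) *\<^sub>R f v = F v"
      using F_sum[OF v(1)] by (simp add: f_def)
    then show ?thesis unfolding v(2) by (simp add: r_def)
  qed
  then have eigen: "B *v v = r *s v"
    by (simp add: F_def vec_eq_iff algebra_simps)
  \<comment> \<open>At a zero of \<open>v\<close> the diagonal term of \<open>B v = r v\<close> drops out, and a sum of nonnegative
    terms vanishes.\<close>
  have zero_step: "v $ l = 0" if "v $ k = 0" "0 < B $ k $ l" for k l
  proof (cases "k = l")
    case False
    have "(\<Sum>j\<in>UNIV - {k}. B $ k $ j * v $ j) = 0"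
      using arg_cong[OF eigen, of "\<lambda>x. x $ k"] that(1)
      by (simp add: matrix_vector_component sum_split_diagonal[of _ k])
    then have "B $ k $ l * v $ l = 0"
      using v(1) off False by (subst (asm) sum_nonneg_eq_0_iff) (auto simp: K_def)
    then show ?thesis using that by simp
  qed (use that in simp)
  have "0 < v $ i" for i
  proof (rule ccontr)
    assume "\<not> 0 < v $ i"
    then have i: "v $ i = 0" using v(1) by (auto simp: K_def intro: antisym)
    have "v $ j = 0" for j
      by (rule irreducible_matrix_induct[OF irr, where P = "\<lambda>i. v $ i = 0"])
        (use i zero_step in auto)
    then show False using v(1) by (simp add: K_def)
  qed
  with eigen show ?thesis by blast
qed

text \<open>
  Compare at the state where \<open>v i / w i\<close> is largest: there \<open>v \<le> c w\<close> with equality at \<open>i\<close>, and the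
  off-diagonal entries preserve the inequality.  In particular all positive eigenvectors belong
  to the same eigenvalue.
\<close>

lemma positive_eigenvalue_le:
  fixes B :: "real ^ 'n::finite ^ 'n"
  assumes off: "\<And>i j. i \<noteq> j \<Longrightarrow> 0 \<le> B $ i $ j"
    and v: "\<And>i. 0 < v $ i" "B *v v = r *s v"
    and w: "\<And>i. 0 < w $ i" "\<And>i. (B *v w) $ i \<le> r' * w $ i"
  shows "r \<le> r'"
proof -
  obtain i c where c: "v $ i = c * w $ i" "\<And>j. v $ j \<le> c * w $ j"
    using exists_maximal_ratio[of "\<lambda>i. w $ i" "\<lambda>i. v $ i"] w(1) by metis
  have "0 < c" using c(1) v(1)[of i] w(1)[of i] by (metis zero_less_mult_pos2)
  have "r * v $ i = B $ i $ i * v $ i + (\<Sum>j\<in>UNIV - {i}. B $ i $ j * v $ j)"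
    using arg_cong[OF v(2), of "\<lambda>x. x $ i"]
    by (simp add: matrix_vector_component sum_split_diagonal[of _ i])
  also have "\<dots> \<le> B $ i $ i * (c * w $ i) + (\<Sum>j\<in>UNIV - {i}. B $ i $ j * (c * w $ j))"
    using c(2) off by (auto simp: c(1) intro!: sum_mono mult_left_mono)
  also have "\<dots> = c * (B *v w) $ i"
    by (simp add: matrix_vector_component sum_split_diagonal[of _ i] sum_distrib_left
        algebra_simps)
  also have "\<dots> \<le> c * (r' * w $ i)"
    using w(2) \<open>0 < c\<close> by (intro mult_left_mono) auto
  also have "\<dots> = r' * v $ i" using c(1) by simp
  finally show ?thesis using v(1)[of i] by simp
qed

text \<open>
  Not the spectral radius: the value can be negative, because the diagonal of the matrix may be.
\<close>

definition principal_eigenvalue :: "real ^ 'n::finite ^ 'n \<Rightarrow> real" where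
  "principal_eigenvalue B = (THE r. \<exists>v. (\<forall>i. 0 < v $ i) \<and> B *v v = r *s v)"

lemma principal_eigenvalue_unique:
  fixes B :: "real ^ 'n::finite ^ 'n"
  assumes off: "\<And>i j. i \<noteq> j \<Longrightarrow> 0 \<le> B $ i $ j"
    and v: "\<And>i. 0 < v $ i" "B *v v = r *s v"
  shows "principal_eigenvalue B = r"
  unfolding principal_eigenvalue_def
proof (rule the_equality)
  fix r' assume "\<exists>w. (\<forall>i. 0 < w $ i) \<and> B *v w = r' *s w"
  then obtain w where w: "\<And>i. 0 < w $ i" "B *v w = r' *s w" by blast
  show "r' = r"
  proof (rule antisym)
    show "r' \<le> r"
      by (rule positive_eigenvalue_le[OF off w v(1)]) (simp_all add: v(2))
    show "r \<le> r'"
      by (rule positive_eigenvalue_le[OF off v w(1)]) (simp_all add: w(2))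
  qed
qed (use v in blast)

lemma principal_eigenvector:
  fixes B :: "real ^ 'n::finite ^ 'n"
  assumes off: "\<And>i j. i \<noteq> j \<Longrightarrow> 0 \<le> B $ i $ j"
    and irr: "irreducible_matrix B"
  obtains v where "\<And>i. 0 < v $ i" "B *v v = principal_eigenvalue B *s v"
proof -
  obtain r v where v: "\<And>i. 0 < v $ i" "B *v v = r *s v"
    using positive_eigenvector_exists[OF assms] by blast
  from off v have "principal_eigenvalue B = r" by (rule principal_eigenvalue_unique)
  with v that show ?thesis by blast
qed

section \<open>The growth rate of a potential\<close>

text \<open>
  The generator of the Feynman-Kac semigroup of the jump process with potential \<open>b\<close>.
\<close>

definition tilted_generator ::
  "('n \<Rightarrow> real) \<Rightarrow> real ^ 'n ^ 'n \<Rightarrow> ('n \<Rightarrow> real) \<Rightarrow> real ^ 'n ^ 'n" where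
  "tilted_generator lam q b = (\<chi> i j. generator lam q $ i $ j + (if i = j then b i else 0))"

lemma tilted_generator_mult:
  fixes q :: "real ^ 'n::finite ^ 'n"
  shows "(tilted_generator lam q b *v v) $ i =
    lam i * (\<Sum>j\<in>UNIV. q $ i $ j * v $ j) - (lam i - b i) * v $ i"
proof -
  have "(tilted_generator lam q b *v v) $ i =
      (\<Sum>j\<in>UNIV. lam i * (q $ i $ j * v $ j) + (if i = j then (b i - lam i) * v $ i else 0))"
    unfolding matrix_vector_component
    by (rule sum.cong) (auto simp: tilted_generator_def generator_def algebra_simps)
  also have "\<dots> = lam i * (\<Sum>j\<in>UNIV. q $ i $ j * v $ j) - (lam i - b i) * v $ i"
    by (simp add: sum.distrib sum_distrib_left algebra_simps)
  finally show ?thesis .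
qed

locale jump_rates =
  fixes lam :: "'n::finite \<Rightarrow> real" and q :: "real ^ 'n ^ 'n"
  assumes lam_pos: "0 < lam i"
    and stochastic: "stochastic_matrix q"
    and irreducible: "irreducible_matrix q"
    and no_loops: "q $ i $ i = 0"
begin

lemma q_nonneg: "0 \<le> q $ i $ j" and q_row: "(\<Sum>j\<in>UNIV. q $ i $ j) = 1"
  using stochastic by (auto simp: stochastic_matrix_def)

lemma tilted_off_diagonal: "i \<noteq> j \<Longrightarrow> 0 \<le> tilted_generator lam q b $ i $ j"
  using q_nonneg[of i j] lam_pos[of i] by (simp add: tilted_generator_def generator_def)

lemma tilted_irreducible: "irreducible_matrix (tilted_generator lam q b)"
proof (rule irreducible_matrix_mono[OF irreducible])
  fix k l assume "0 < q $ k $ l"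
  moreover from this have "k \<noteq> l" using no_loops by auto
  ultimately show "0 < tilted_generator lam q b $ k $ l"
    using lam_pos[of k] by (simp add: tilted_generator_def generator_def)
qed

text \<open>
  The exponential rate at which \<open>E\<^sub>i[exp (\<integral>\<^sub>0\<^sup>t b(X\<^sub>u) du)]\<close> grows with \<open>t\<close>.
\<close>

definition growth_rate :: "('n \<Rightarrow> real) \<Rightarrow> real" where
  "growth_rate b = principal_eigenvalue (tilted_generator lam q b)"

text \<open>
  The eigenvalue equation is used throughout in this form, with the diagonal moved to the
  right-hand side: dividing by \<open>lam i - b i + growth_rate b\<close> yields the jump chain matrix, and
  multiplying out a single exponential holding time yields the Feynman-Kac martingale.
\<close>

lemma growth_rate_eigenvector:
  obtains v where "\<And>i. 0 < v $ i"
    "\<And>i. lam i * (\<Sum>j\<in>UNIV. q $ i $ j * v $ j) = (lam i - b i + growth_rate b) * v $ i"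
proof -
  obtain v where v: "\<And>i. 0 < v $ i"
      "tilted_generator lam q b *v v = growth_rate b *s v"
    using principal_eigenvector[OF tilted_off_diagonal tilted_irreducible]
    unfolding growth_rate_def by metis
  have "lam i * (\<Sum>j\<in>UNIV. q $ i $ j * v $ j) = (lam i - b i + growth_rate b) * v $ i" for i
    using arg_cong[OF v(2), of "\<lambda>x. x $ i"] by (simp add: tilted_generator_mult algebra_simps)
  with v(1) that show ?thesis by blast
qed

lemma growth_rate_unique:
  assumes "\<And>i. 0 < v $ i"
    "\<And>i. lam i * (\<Sum>j\<in>UNIV. q $ i $ j * v $ j) = (lam i - b i + r) * v $ i"
  shows "growth_rate b = r"
  unfolding growth_rate_def
  by (rule principal_eigenvalue_unique[OF tilted_off_diagonal assms(1)])
    (simp_all add: vec_eq_iff tilted_generator_mult assms(2), simp add: algebra_simps)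

lemma growth_rate_le:
  assumes "\<And>i. 0 < w $ i"
    "\<And>i. lam i * (\<Sum>j\<in>UNIV. q $ i $ j * w $ j) \<le> (lam i - b i + r) * w $ i"
  shows "growth_rate b \<le> r"
proof -
  obtain v where v: "\<And>i. 0 < v $ i" "tilted_generator lam q b *v v = growth_rate b *s v"
    using principal_eigenvector[OF tilted_off_diagonal tilted_irreducible]
    unfolding growth_rate_def by metis
  show ?thesis
  proof (rule positive_eigenvalue_le[OF tilted_off_diagonal v assms(1)])
    show "(tilted_generator lam q b *v w) $ i \<le> r * w $ i" for i
      using assms(2)[of i] by (simp add: tilted_generator_mult algebra_simps)
  qed
qed

lemma growth_rate_zero: "growth_rate (\<lambda>i. 0) = 0"
  by (rule growth_rate_unique[of "\<chi> i. 1"]) (simp_all add: q_row)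

text \<open>
  Staying at \<open>i\<close> forever costs \<open>lam i\<close> and gains \<open>b i\<close>.
\<close>

lemma growth_rate_ge: "b i - lam i \<le> growth_rate b"
proof -
  obtain v where v: "\<And>i. 0 < v $ i"
    "\<And>i. lam i * (\<Sum>j\<in>UNIV. q $ i $ j * v $ j) = (lam i - b i + growth_rate b) * v $ i"
    using growth_rate_eigenvector[of b] by metis
  have "0 \<le> (lam i - b i + growth_rate b) * v $ i"
    unfolding v(2)[symmetric] using lam_pos[of i] v(1) q_nonneg
    by (intro mult_nonneg_nonneg sum_nonneg) (auto intro: less_imp_le)
  then show ?thesis using v(1)[of i] by (simp add: zero_le_mult_iff)
qed

text \<open>
  The geometric mean \<open>u\<close> of the eigenvectors of two potentials is a supersolution for the mean
  potential, since Young's inequality bounds each ratio \<open>u j / u i\<close> by the arithmetic mean of the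
  two ratios.
\<close>

lemma growth_rate_convex:
  assumes "0 \<le> \<alpha>" "0 \<le> \<beta>" "\<alpha> + \<beta> = 1"
  shows "growth_rate (\<lambda>i. \<alpha> * b i + \<beta> * c i) \<le> \<alpha> * growth_rate b + \<beta> * growth_rate c"
proof -
  obtain x where x: "\<And>i. 0 < x $ i"
    "\<And>i. lam i * (\<Sum>j\<in>UNIV. q $ i $ j * x $ j) = (lam i - b i + growth_rate b) * x $ i"
    using growth_rate_eigenvector[of b] by metis
  obtain y where y: "\<And>i. 0 < y $ i"
    "\<And>i. lam i * (\<Sum>j\<in>UNIV. q $ i $ j * y $ j) = (lam i - c i + growth_rate c) * y $ i"
    using growth_rate_eigenvector[of c] by metis
  define u where "u = (\<chi> i. x $ i powr \<alpha> * y $ i powr \<beta>)"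
  have u: "0 < u $ i" for i using x(1)[of i] y(1)[of i] by (simp add: u_def)
  have ratio: "u $ j \<le> u $ i * (\<alpha> * (x $ j / x $ i) + \<beta> * (y $ j / y $ i))" for i j
  proof -
    have "u $ j = u $ i * ((x $ j / x $ i) powr \<alpha> * (y $ j / y $ i) powr \<beta>)"
      using x(1)[of i] y(1)[of i] x(1)[of j] y(1)[of j] by (simp add: u_def powr_divide)
    also have "\<dots> \<le> u $ i * (\<alpha> * (x $ j / x $ i) + \<beta> * (y $ j / y $ i))"
      using x(1) y(1) u assms by (intro mult_left_mono Youngs_inequality_0) (auto intro: less_imp_le)
    finally show ?thesis .
  qed
  show ?thesis
  proof (rule growth_rate_le[of u])
    fix i
    have "lam i * (\<Sum>j\<in>UNIV. q $ i $ j * u $ j) \<le>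
        lam i * (\<Sum>j\<in>UNIV. q $ i $ j * (u $ i * (\<alpha> * (x $ j / x $ i) + \<beta> * (y $ j / y $ i))))"
      using lam_pos[of i] q_nonneg ratio by (intro mult_left_mono sum_mono) auto
    also have "\<dots> = u $ i * (\<alpha> / x $ i * (lam i * (\<Sum>j\<in>UNIV. q $ i $ j * x $ j)) +
        \<beta> / y $ i * (lam i * (\<Sum>j\<in>UNIV. q $ i $ j * y $ j)))"
      by (simp add: sum_distrib_left sum.distrib[symmetric] algebra_simps)
    also have "\<dots> = u $ i * (\<alpha> * (lam i - b i + growth_rate b) +
        \<beta> * (lam i - c i + growth_rate c))"
      unfolding x(2) y(2) using x(1)[of i] y(1)[of i] by simp
    also have "\<dots> = (lam i - (\<alpha> * b i + \<beta> * c i) +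
        (\<alpha> * growth_rate b + \<beta> * growth_rate c)) * u $ i"
    proof -
      have \<beta>: "\<beta> = 1 - \<alpha>" using assms(3) by simp
      show ?thesis unfolding \<beta> by (simp add: algebra_simps)
    qed
    finally show "lam i * (\<Sum>j\<in>UNIV. q $ i $ j * u $ j) \<le> (lam i - (\<alpha> * b i + \<beta> * c i) +
        (\<alpha> * growth_rate b + \<beta> * growth_rate c)) * u $ i" .
  qed (rule u)
qed

text \<open>
  The maximum principle: the set where a harmonic function attains its maximum is closed under
  transitions.
\<close>

lemma harmonic_constant:
  assumes h: "\<And>i. (\<Sum>j\<in>UNIV. q $ i $ j * h $ j) = h $ i"
  shows "h $ i = h $ j"
proof -
  define m where "m = Max (range (\<lambda>i. h $ i))"
  have le: "h $ i \<le> m" for i unfolding m_def by (rule Max_ge) auto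
  have "m \<in> range (\<lambda>i. h $ i)" unfolding m_def by (rule Max_in) auto
  then obtain k where k: "h $ k = m" by auto
  have "h $ l = m" for l
  proof (rule irreducible_matrix_induct[OF irreducible, where P = "\<lambda>i. h $ i = m"])
    show "h $ k = m" by (rule k)
    fix k l assume kl: "h $ k = m" "0 < q $ k $ l"
    have "(\<Sum>j\<in>UNIV. q $ k $ j * (m - h $ j)) = m * (\<Sum>j\<in>UNIV. q $ k $ j) - h $ k"
      unfolding h[of k, symmetric] by (simp add: sum_distrib_left sum_subtractf algebra_simps)
    also have "\<dots> = 0" using kl q_row by simp
    finally have "q $ k $ l * (m - h $ l) = 0"
      using le q_nonneg by (subst (asm) sum_nonneg_eq_0_iff) auto
    then show "h $ l = m" using kl by simp
  qed
  then show ?thesis by metis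
qed

text \<open>
  The generator \<open>G\<close> itself is singular.  Subtracting \<open>\<Sum>j. h j\<close> from every component of \<open>G h\<close> makes
  it injective: pairing with \<open>\<mu>\<close> kills \<open>G h\<close>, so \<open>\<Sum>j. h j = 0\<close> and \<open>G h = 0\<close>, and a harmonic
  \<open>h\<close> with zero sum vanishes.  An injective endomorphism is surjective, and pairing the solution
  for \<open>- a\<close> with \<open>\<mu>\<close> again identifies \<open>\<Sum>j. h j\<close> as the mean of \<open>a\<close>.
\<close>

lemma poisson_equation:
  assumes \<mu>: "invariant_probability lam q \<mu>"
  obtains h where "\<And>i. lam i * ((\<Sum>j\<in>UNIV. q $ i $ j * h $ j) - h $ i) =
    (\<Sum>j\<in>UNIV. a j * \<mu> j) - a i"
proof -
  define T :: "real ^ 'n \<Rightarrow> real ^ 'n" where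
    "T h = tilted_generator lam q (\<lambda>i. 0) *v h - (\<chi> i. \<Sum>j\<in>UNIV. h $ j)" for h
  have T: "T h $ i = lam i * ((\<Sum>j\<in>UNIV. q $ i $ j * h $ j) - h $ i) - (\<Sum>j\<in>UNIV. h $ j)" for h i
    by (simp add: T_def tilted_generator_mult algebra_simps)
  have \<mu>G: "(\<Sum>i\<in>UNIV. \<mu> i * (lam i * ((\<Sum>j\<in>UNIV. q $ i $ j * h $ j) - h $ i))) = 0"
    for h :: "real ^ 'n"
  proof -
    have "(\<Sum>i\<in>UNIV. \<mu> i * (lam i * ((\<Sum>j\<in>UNIV. q $ i $ j * h $ j) - h $ i))) =
        (\<Sum>i\<in>UNIV. \<mu> i * (tilted_generator lam q (\<lambda>i. 0) *v h) $ i)"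
      by (simp add: tilted_generator_mult algebra_simps)
    also have "\<dots> = (\<Sum>i\<in>UNIV. \<Sum>j\<in>UNIV. \<mu> i * generator lam q $ i $ j * h $ j)"
      by (simp add: matrix_vector_component tilted_generator_def sum_distrib_left mult.assoc
          cong: if_cong)
    also have "\<dots> = (\<Sum>j\<in>UNIV. (\<Sum>i\<in>UNIV. \<mu> i * generator lam q $ i $ j) * h $ j)"
      by (subst sum.swap) (simp add: sum_distrib_right)
    also have "\<dots> = 0" using \<mu> by (simp add: invariant_probability_def)
    finally show ?thesis .
  qed
  have \<mu>1: "(\<Sum>i\<in>UNIV. \<mu> i) = 1" using \<mu> by (simp add: invariant_probability_def)
  have "linear T"
    by (rule linearI)
      (simp_all add: vec_eq_iff T sum.distrib sum_distrib_left algebra_simps)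
  moreover have "inj T"
    unfolding linear_injective_0[OF \<open>linear T\<close>]
  proof (intro allI impI)
    fix h assume h: "T h = 0"
    define c where "c = (\<Sum>j\<in>UNIV. h $ j)"
    have hc: "lam i * ((\<Sum>j\<in>UNIV. q $ i $ j * h $ j) - h $ i) = c" for i
      using T[of h i] h by (simp add: c_def)
    have "c = 0" using \<mu>G[of h] \<mu>1 unfolding hc by (simp flip: sum_distrib_right)
    have "(\<Sum>j\<in>UNIV. q $ i $ j * h $ j) = h $ i" for i
      using hc[of i] lam_pos[of i] \<open>c = 0\<close> by simp
    then have const: "h $ i = h $ j" for i j by (rule harmonic_constant)
    have "h $ i = 0" for i
    proof -
      have "c = (\<Sum>j\<in>(UNIV :: 'n set). h $ i)"
        unfolding c_def by (rule sum.cong) (auto intro: const)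
      with \<open>c = 0\<close> show ?thesis by simp
    qed
    then show "h = 0" by (simp add: vec_eq_iff)
  qed
  ultimately have "surj T" by (rule linear_inj_imp_surj)
  then obtain h where h: "T h = (\<chi> i. - a i)" by (metis surjD)
  define c where "c = (\<Sum>j\<in>UNIV. h $ j)"
  have hc: "lam i * ((\<Sum>j\<in>UNIV. q $ i $ j * h $ j) - h $ i) = c - a i" for i
    using T[of h i] h by (simp add: c_def)
  have "(\<Sum>i\<in>UNIV. \<mu> i * (c - a i)) = 0" using \<mu>G[of h] unfolding hc .
  then have "c = (\<Sum>j\<in>UNIV. a j * \<mu> j)"
    using \<mu>1 by (simp add: algebra_simps sum_subtractf flip: sum_distrib_left)
  with hc that show ?thesis by metis
qed

text \<open>
  First-order perturbation at \<open>s = 0\<close>: with \<open>h\<close> from the Poisson equation, \<open>1 + s h\<close> is an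
  eigenvector up to \<open>s\<^sup>2\<close> for the eigenvalue \<open>s m\<close>, where \<open>m < 0\<close> is the mean of \<open>a\<close>.  For small
  \<open>s\<close> half of \<open>s m\<close> absorbs the quadratic error.
\<close>

lemma growth_rate_negative:
  assumes \<mu>: "invariant_probability lam q \<mu>"
    and drift: "(\<Sum>i\<in>UNIV. a i * \<mu> i) < 0"
  shows "\<exists>s>0. growth_rate (\<lambda>i. s * a i) < 0"
proof -
  define m where "m = (\<Sum>i\<in>UNIV. a i * \<mu> i)"
  obtain h where h: "\<And>i. lam i * ((\<Sum>j\<in>UNIV. q $ i $ j * h $ j) - h $ i) = m - a i"
    using poisson_equation[OF \<mu>] unfolding m_def by metis
  \<comment> \<open>\<open>1 / H\<close> is small enough for \<open>1 + s h\<close> to be positive, \<open>- m / (2 H)\<close> for the quadratic error.\<close>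
  define H where "H = Max (range (\<lambda>i. \<bar>h $ i\<bar>)) + Max (range (\<lambda>i. \<bar>a i * h $ i - m / 2 * h $ i\<bar>)) + 1"
  have H: "\<bar>h $ i\<bar> < H" "\<bar>a i * h $ i - m / 2 * h $ i\<bar> < H" for i
  proof -
    have "\<bar>h $ i\<bar> \<le> Max (range (\<lambda>i. \<bar>h $ i\<bar>))"
      "\<bar>a i * h $ i - m / 2 * h $ i\<bar> \<le> Max (range (\<lambda>i. \<bar>a i * h $ i - m / 2 * h $ i\<bar>))"
      by (rule Max_ge; simp)+
    then show "\<bar>h $ i\<bar> < H" "\<bar>a i * h $ i - m / 2 * h $ i\<bar> < H"
      unfolding H_def by linarith+
  qed
  have "0 < H" using H(1)[of undefined] by linarith
  define s where "s = min (1 / H) (- m / (2 * H))"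
  have s: "0 < s" "s * H \<le> 1" "s * H \<le> - m / 2"
    using \<open>0 < H\<close> drift[folded m_def] by (auto simp: s_def min_def field_simps)
  define v where "v = (\<chi> i. 1 + s * h $ i)"
  have v: "0 < v $ i" for i
  proof -
    have "\<bar>s * h $ i\<bar> < s * H" using H(1)[of i] s(1) by (simp add: abs_mult)
    then show ?thesis using s(2) by (simp add: v_def)
  qed
  have "growth_rate (\<lambda>i. s * a i) \<le> s * m / 2"
  proof (rule growth_rate_le[OF v])
    fix i
    have "s * \<bar>a i * h $ i - m / 2 * h $ i\<bar> \<le> s * H" using H(2)[of i] s(1) by simp
    then have "s * (a i * h $ i - m / 2 * h $ i) \<le> - m / 2"
      using s by (smt (verit) mult_left_mono)
    then have *: "s * (s * (a i * h $ i - m / 2 * h $ i)) \<le> s * (- m / 2)"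
      using s(1) by (intro mult_left_mono) auto
    have "lam i * (\<Sum>j\<in>UNIV. q $ i $ j * v $ j) =
        lam i + s * (lam i * (\<Sum>j\<in>UNIV. q $ i $ j * h $ j))"
      by (simp add: v_def algebra_simps sum.distrib sum_distrib_left q_row
          flip: sum_distrib_left)
    also have "\<dots> = lam i + s * (m - a i + lam i * h $ i)"
    proof -
      have "lam i * (\<Sum>j\<in>UNIV. q $ i $ j * h $ j) = m - a i + lam i * h $ i"
        using h[of i] by (simp add: algebra_simps)
      then show ?thesis by simp
    qed
    also have "\<dots> \<le> (lam i - s * a i + s * m / 2) * v $ i"
      using * by (simp add: v_def algebra_simps)
    finally show "lam i * (\<Sum>j\<in>UNIV. q $ i $ j * v $ j) \<le> (lam i - s * a i + s * m / 2) * v $ i" .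
  qed
  moreover have "s * m / 2 < 0" using s drift by (simp add: m_def mult_pos_neg)
  ultimately show ?thesis using s(1) by force
qed

text \<open>
  As a function of \<open>s\<close> the growth rate is convex, hence continuous; it is zero at \<open>0\<close>, negative
  somewhere to the right of \<open>0\<close> because the drift is negative, and at least
  \<open>s * a k - lam k\<close>.  A convex function with these properties has exactly one positive zero.
\<close>

lemma growth_rate_unique_zero:
  assumes \<mu>: "invariant_probability lam q \<mu>"
    and drift: "(\<Sum>i\<in>UNIV. a i * \<mu> i) < 0"
    and a: "0 < a k"
  shows "\<exists>!s. 0 < s \<and> growth_rate (\<lambda>i. s * a i) = 0"
proof -
  define L where "L s = growth_rate (\<lambda>i. s * a i)" for s
  have convex: "convex_on UNIV L"
  proof (rule convex_onI)
    fix t x y :: real assume "0 < t" "t < 1"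
    then show "L ((1 - t) *\<^sub>R x + t *\<^sub>R y) \<le> (1 - t) * L x + t * L y"
      using growth_rate_convex[of "1 - t" t "\<lambda>i. x * a i" "\<lambda>i. y * a i"]
      by (simp add: L_def algebra_simps)
  qed simp
  have L0: "L 0 = 0" by (simp add: L_def growth_rate_zero)
  obtain r where r: "0 < r" "L r < 0"
    using growth_rate_negative[OF \<mu> drift] by (auto simp: L_def)
  define t where "t = max r (lam k / a k)"
  have "lam k \<le> t * a k" using a by (simp add: t_def max_def field_simps)
  then have t: "r \<le> t" "0 \<le> L t"
    using growth_rate_ge[of "\<lambda>i. t * a i" k] by (simp_all add: L_def t_def)
  have "continuous_on {r..t} L"
    using convex_on_continuous[OF open_UNIV convex] continuous_on_subset by blast
  then obtain \<kappa> where \<kappa>: "r \<le> \<kappa>" "L \<kappa> = 0"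
    using IVT'[of L r 0 t] r t by auto
  \<comment> \<open>Convexity makes \<open>L\<close> negative strictly between \<open>0\<close> and \<open>r\<close>, and strictly between \<open>r\<close> and
    any zero beyond it.\<close>
  have uniq: "False" if xy: "0 < x" "x < y" "L x = 0" "L y = 0" for x y
  proof (cases "r < x")
    case True
    define \<theta> where "\<theta> = (x - r) / (y - r)"
    have "\<theta> * (y - r) = x - r" using True xy by (simp add: \<theta>_def)
    moreover have "0 < \<theta>" "\<theta> < 1" using True xy by (auto simp: \<theta>_def)
    ultimately have \<theta>: "0 < \<theta>" "\<theta> < 1" "x = (1 - \<theta>) *\<^sub>R r + \<theta> *\<^sub>R y"
      by (auto simp: algebra_simps)
    have "L x \<le> (1 - \<theta>) * L r + \<theta> * L y"
      unfolding \<theta>(3) using \<theta> by (intro convex_onD[OF convex]) auto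
    moreover have "(1 - \<theta>) * L r < 0" using \<theta> r by (intro mult_pos_neg) auto
    ultimately show False using xy by simp
  next
    case False
    then have "x < r" using r xy by (cases "x = r") auto
    define \<theta> where "\<theta> = x / r"
    have \<theta>: "0 < \<theta>" "\<theta> < 1" "x = (1 - \<theta>) *\<^sub>R 0 + \<theta> *\<^sub>R r"
      using \<open>x < r\<close> r xy by (auto simp: \<theta>_def field_simps)
    have "L x \<le> (1 - \<theta>) * L 0 + \<theta> * L r"
      unfolding \<theta>(3) using \<theta> by (intro convex_onD[OF convex]) auto
    moreover have "\<theta> * L r < 0" using \<theta> r by (intro mult_pos_neg) auto
    ultimately show False using xy L0 by simp
  qed
  show ?thesis
    unfolding L_def[symmetric]
  proof (rule ex1I[of _ \<kappa>])
    show "0 < \<kappa> \<and> L \<kappa> = 0" using \<kappa> r by auto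
    fix s assume "0 < s \<and> L s = 0"
    then show "s = \<kappa>"
      using uniq[of s \<kappa>] uniq[of \<kappa> s] \<kappa> r by (cases s \<kappa> rule: linorder_cases) auto
  qed
qed

subsection \<open>The matrices of the jump chain\<close>

lemma less_s1_iff:
  assumes "0 < a k" and "0 < s"
  shows "s < s1 lam a \<longleftrightarrow> (\<forall>i. 0 < lam i - s * a i)"
proof -
  have "s < s1 lam a \<longleftrightarrow> (\<forall>x\<in>{lam i / a i | i. a i > 0}. s < x)"
    unfolding s1_def using assms(1) by (subst Min_gr_iff) auto
  also have "\<dots> \<longleftrightarrow> (\<forall>i. 0 < a i \<longrightarrow> s < lam i / a i)" by blast
  also have "\<dots> \<longleftrightarrow> (\<forall>i. 0 < lam i - s * a i)"
  proof (intro iff_allI)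
    fix i
    show "(0 < a i \<longrightarrow> s < lam i / a i) \<longleftrightarrow> 0 < lam i - s * a i"
    proof (cases "0 < a i")
      case False
      then have "s * a i \<le> 0" using assms(2) by (simp add: mult_le_0_iff)
      then show ?thesis using False lam_pos[of i] by simp
    qed (simp add: field_simps)
  qed
  finally show ?thesis .
qed

lemma M_matrix_mult:
  "(M_matrix lam q a s *v v) $ i = lam i * (\<Sum>j\<in>UNIV. q $ i $ j * v $ j) / (lam i - s * a i)"
  by (simp add: matrix_vector_component M_matrix_def sum_distrib_left sum_divide_distrib mult_ac)

text \<open>
  For \<open>s < s1 lam a\<close> the equations \<open>M v = v\<close> and \<open>(G + s a) v = 0\<close> are the same up to division of
  each row by \<open>lam i - s * a i > 0\<close>.  Conversely a positive solution of the second forces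
  \<open>s < s1 lam a\<close>, since \<open>lam i * (\<Sum>j. q i j * v j)\<close> is positive.
\<close>

lemma M_matrix_radius_one_iff:
  assumes a: "0 < a k" and s: "0 < s"
  shows "s < s1 lam a \<and> spectral_radius (M_matrix lam q a s) = 1 \<longleftrightarrow>
    growth_rate (\<lambda>i. s * a i) = 0"
proof
  assume *: "s < s1 lam a \<and> spectral_radius (M_matrix lam q a s) = 1"
  then have pos: "0 < lam i - s * a i" for i using less_s1_iff[of a k s, OF a s] by blast
  have nonneg: "0 \<le> M_matrix lam q a s $ i $ j" for i j
    using q_nonneg[of i j] lam_pos[of i] pos[of i] by (simp add: M_matrix_def)
  have "irreducible_matrix (M_matrix lam q a s)"
    by (rule irreducible_matrix_mono[OF irreducible])
      (use lam_pos pos in \<open>simp add: M_matrix_def\<close>)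
  then obtain r v where v: "\<And>i. 0 < v $ i" "M_matrix lam q a s *v v = r *s v"
    using positive_eigenvector_exists nonneg by metis
  have "r = 1" using spectral_radius_eq_positive_eigenvalue[OF nonneg v] * by simp
  show "growth_rate (\<lambda>i. s * a i) = 0"
  proof (rule growth_rate_unique[OF v(1)])
    fix i
    show "lam i * (\<Sum>j\<in>UNIV. q $ i $ j * v $ j) = (lam i - s * a i + 0) * v $ i"
      using arg_cong[OF v(2), of "\<lambda>x. x $ i"] \<open>r = 1\<close> pos[of i]
      by (simp add: M_matrix_mult divide_eq_eq mult.commute)
  qed
next
  assume *: "growth_rate (\<lambda>i. s * a i) = 0"
  obtain v where v: "\<And>i. 0 < v $ i"
    "\<And>i. lam i * (\<Sum>j\<in>UNIV. q $ i $ j * v $ j) = (lam i - s * a i) * v $ i"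
    using growth_rate_eigenvector[of "\<lambda>i. s * a i"] unfolding * by auto
  have pos: "0 < lam i - s * a i" for i
  proof -
    have "\<exists>j. 0 < q $ i $ j"
      using q_row[of i] q_nonneg by (metis less_eq_real_def sum.neutral zero_neq_one)
    then obtain j where "0 < q $ i $ j" ..
    then have "0 < (\<Sum>j\<in>UNIV. q $ i $ j * v $ j)"
      using q_nonneg v(1) by (intro sum_pos2[of UNIV j] mult_pos_pos mult_nonneg_nonneg)
        (auto intro: less_imp_le)
    then have "0 < (lam i - s * a i) * v $ i"
      unfolding v(2)[symmetric] using lam_pos by simp
    then show ?thesis using v(1)[of i] by (simp add: zero_less_mult_iff)
  qed
  have "spectral_radius (M_matrix lam q a s) = 1"
  proof (rule spectral_radius_eq_positive_eigenvalue[OF _ v(1)])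
    show "0 \<le> M_matrix lam q a s $ i $ j" for i j
      using q_nonneg[of i j] lam_pos[of i] pos[of i] by (simp add: M_matrix_def)
    show "M_matrix lam q a s *v v = 1 *s v"
      using pos by (simp add: vec_eq_iff M_matrix_mult v(2) less_imp_neq[symmetric])
  qed
  with pos show "s < s1 lam a \<and> spectral_radius (M_matrix lam q a s) = 1"
    using less_s1_iff[of a k s, OF a s] by blast
qed

text \<open>
  Stationary mass flows along every transition of positive probability, so by irreducibility it
  reaches all states.  Hence conditioning on any initial state makes sense.
\<close>

lemma invariant_probability_pos:
  assumes \<mu>: "invariant_probability lam q \<mu>"
  shows "0 < \<mu> i"
proof -
  have nonneg: "0 \<le> \<mu> i" and bal: "(\<Sum>i\<in>UNIV. \<mu> i * generator lam q $ i $ j) = 0" for i j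
    using \<mu> by (auto simp: invariant_probability_def)
  have "\<exists>k. 0 < \<mu> k"
    using \<mu> unfolding invariant_probability_def
    by (metis less_eq_real_def sum.neutral zero_neq_one)
  then obtain k where "0 < \<mu> k" ..
  show ?thesis
  proof (rule irreducible_matrix_induct[OF irreducible, where P = "\<lambda>i. 0 < \<mu> i"])
    show "0 < \<mu> k" by fact
    fix k l assume kl: "0 < \<mu> k" "0 < q $ k $ l"
    have "\<mu> l * lam l = (\<Sum>i\<in>UNIV. \<mu> i * lam i * q $ i $ l)"
    proof -
      have "(\<Sum>i\<in>UNIV. \<mu> i * generator lam q $ i $ l) =
          (\<Sum>i\<in>UNIV. \<mu> i * lam i * q $ i $ l - (if i = l then \<mu> l * lam l else 0))"
        by (rule sum.cong) (auto simp: generator_def algebra_simps)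
      then show ?thesis using bal[of l] by (simp add: sum_subtractf)
    qed
    also have "0 < \<dots>"
      using kl nonneg lam_pos q_nonneg by (intro sum_pos2[of UNIV k] mult_pos_pos mult_nonneg_nonneg)
        (auto intro: less_imp_le)
    finally show "0 < \<mu> l" using lam_pos[of l] by (simp add: zero_less_mult_iff)
  qed
qed

end


section \<open>One exponential holding time\<close>

lemma integral_uniform_measure:
  fixes f :: "'w \<Rightarrow> real"
  assumes "A \<in> sets M" and "f \<in> borel_measurable M"
    and "emeasure M A \<noteq> 0" and "emeasure M A \<noteq> \<infinity>"
  shows "integral\<^sup>L (uniform_measure M A) f = (\<integral>x. indicator A x * f x \<partial>M) / measure M A"
proof -
  have pos: "0 < measure M A"
    using assms(3,4) by (metis emeasure_eq_ennreal_measure enn2real_0 ennreal_0 infinity_ennreal_def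
        measure_nonneg order_less_le)
  have "uniform_measure M A = density M (\<lambda>x. ennreal (indicator A x / measure M A))"
    unfolding uniform_measure_def
  proof (rule density_cong)
    show "AE x in M. indicator A x / emeasure M A = ennreal (indicator A x / measure M A)"
      using assms(4) pos
      by (auto simp: emeasure_eq_ennreal_measure divide_ennreal[symmetric] split: split_indicator)
  qed (use assms(1) in measurable)
  then have "integral\<^sup>L (uniform_measure M A) f =
      (\<integral>x. (indicator A x / measure M A) *\<^sub>R f x \<partial>M)"
    using assms(1,2) by (simp add: integral_density)
  then show ?thesis by simp
qed

definition exponential_law :: "real \<Rightarrow> real measure" where
  "exponential_law l = density lborel (\<lambda>x. ennreal (exponential_density l x))"

lemma sets_exponential_law [measurable_cong, simp]: "sets (exponential_law l) = sets borel"
  and space_exponential_law [simp]: "space (exponential_law l) = UNIV"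
  by (simp_all add: exponential_law_def)

lemma prob_space_exponential_law: "0 < l \<Longrightarrow> prob_space (exponential_law l)"
  unfolding exponential_law_def by (rule prob_space_exponential_density)

text \<open>
  One step of the Feynman-Kac martingale.  In a state with rate \<open>l\<close> and potential \<open>b\<close>, let \<open>v\<close> be
  the present value and \<open>w\<close> the mean value after a jump.  Either the holding time exceeds the
  remaining time \<open>R\<close>, and \<open>v\<close> is multiplied by \<open>exp (b * R)\<close>, or the jump happens at \<open>x \<le> R\<close>, and
  \<open>w\<close> is multiplied by \<open>exp (b * x)\<close>.  The eigenvalue equation balances the two.
\<close>

lemma exponential_law_one_step:
  fixes l b R v w :: real
  assumes l: "0 < l" and R: "0 \<le> R" and vw: "l * w = (l - b) * v"
  shows "(\<integral>x. v - (if R < x then exp (b * R) * v else 0) -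
      (if 0 \<le> x \<and> x \<le> R then exp (b * x) * w else 0) \<partial>exponential_law l) = 0"
proof -
  let ?g = "\<lambda>x. v - (if R < x then exp (b * R) * v else 0) -
    (if 0 \<le> x \<and> x \<le> R then exp (b * x) * w else 0)"
  \<comment> \<open>Substituting \<open>l * w = (l - b) * v\<close> makes the integrand on \<open>[0, R]\<close>, after the constant
    \<open>v - exp (b * R) * v\<close> is split off, an exact derivative.\<close>
  define F where "F x = exp (- (l - b) * x) * v - exp (- l * x) * (exp (b * R) * v)" for x
  define f where "f x = l * exp (- l * x) * (exp (b * R) * v) - (l - b) * exp (- (l - b) * x) * v"
    for x
  have "has_bochner_integral lborel (\<lambda>x. f x * indicator {0..R} x) (F R - F 0)"
  proof (rule has_bochner_integral_FTC_Icc_real[OF R])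
    show "DERIV F x :> f x" for x
      unfolding F_def f_def by (auto intro!: derivative_eq_intros simp: algebra_simps)
    show "isCont f x" for x unfolding f_def by (intro continuous_intros)
  qed
  moreover have "has_bochner_integral lborel
      (\<lambda>x. exponential_density l x * (v - exp (b * R) * v)) (1 * (v - exp (b * R) * v))"
  proof (rule has_bochner_integral_mult_left)
    interpret D: prob_space "exponential_law l" by (rule prob_space_exponential_law[OF l])
    have "integrable (exponential_law l) (\<lambda>x. 1 :: real)" by simp
    then have "integrable lborel (exponential_density l)"
      unfolding exponential_law_def using l by (subst (asm) integrable_density) auto
    moreover have "integral\<^sup>L lborel (exponential_density l) = 1"
    proof -
      have "integral\<^sup>L (exponential_law l) (\<lambda>x. 1 :: real) = 1"
        using D.prob_space by simp
      then show ?thesis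
        unfolding exponential_law_def using l by (subst (asm) integral_density) auto
    qed
    ultimately show "has_bochner_integral lborel (exponential_density l) 1"
      by (simp add: has_bochner_integral_iff)
  qed
  ultimately have *: "has_bochner_integral lborel
      (\<lambda>x. exponential_density l x * (v - exp (b * R) * v) + f x * indicator {0..R} x)
      (1 * (v - exp (b * R) * v) + (F R - F 0))"
    by (rule has_bochner_integral_add[rotated])
  have "1 * (v - exp (b * R) * v) + (F R - F 0) = 0"
    by (simp add: F_def algebra_simps flip: exp_add)
  moreover have "exponential_density l x * (v - exp (b * R) * v) + f x * indicator {0..R} x =
      exponential_density l x * ?g x" for x
  proof -
    have "(l - b) * exp (- (l - b) * x) * v = l * exp (- l * x) * (exp (b * x) * w)"
    proof -
      have "exp (- (l - b) * x) = exp (- l * x) * exp (b * x)"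
        by (simp add: algebra_simps flip: exp_add)
      then have "(l - b) * exp (- (l - b) * x) * v = exp (- l * x) * exp (b * x) * ((l - b) * v)"
        by simp
      then show ?thesis unfolding vw[symmetric] by simp
    qed
    then show ?thesis
      using R by (auto simp: exponential_density_def f_def algebra_simps split: split_indicator)
  qed
  ultimately have "(\<integral>x. exponential_density l x * ?g x \<partial>lborel) = 0"
    using * by (simp add: has_bochner_integral_iff)
  then show ?thesis
    unfolding exponential_law_def using l by (subst integral_density) auto
qed

section \<open>Weights along a sequence of jumps\<close>

definition jump_time :: "nat \<Rightarrow> (nat \<Rightarrow> real) \<Rightarrow> real" where
  "jump_time n s = (\<Sum>k<n. s k)"

text \<open>
  The \<open>n\<close>-th jump occurs by time \<open>t\<close>.  Requiring nonnegative holding times keeps the weights below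
  bounded on all real sequences, so that they can be integrated against product measures.
\<close>

definition reaches :: "real \<Rightarrow> nat \<Rightarrow> (nat \<Rightarrow> real) \<Rightarrow> bool" where
  "reaches t n s \<longleftrightarrow> (\<forall>k\<in>{..<n}. 0 \<le> s k) \<and> jump_time n s \<le> t"

text \<open>
  The weight accumulated up to the \<open>n\<close>-th jump, for paths on which that jump occurs by time \<open>t\<close>.
  Here \<open>y\<close> is the sequence of visited states and \<open>s\<close> the sequence of holding times.
\<close>

definition weight_at_jump ::
  "('n \<Rightarrow> real) \<Rightarrow> ('n \<Rightarrow> real) \<Rightarrow> real \<Rightarrow> nat \<Rightarrow> (nat \<Rightarrow> 'n) \<Rightarrow> (nat \<Rightarrow> real) \<Rightarrow> real" where
  "weight_at_jump b v t n y s =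
    (if reaches t n s then exp (\<Sum>k<n. b (y k) * s k) * v (y n) else 0)"

text \<open>
  The weight accumulated up to time \<open>t\<close> itself, for paths with exactly \<open>n\<close> jumps by time \<open>t\<close>.
\<close>

definition final_weight ::
  "('n \<Rightarrow> real) \<Rightarrow> ('n \<Rightarrow> real) \<Rightarrow> real \<Rightarrow> nat \<Rightarrow> (nat \<Rightarrow> 'n) \<Rightarrow> (nat \<Rightarrow> real) \<Rightarrow> real" where
  "final_weight b v t n y s =
    (if reaches t n s \<and> t < jump_time (Suc n) s
     then exp ((\<Sum>k<n. b (y k) * s k) + b (y n) * (t - jump_time n s)) * v (y n) else 0)"

text \<open>
  The time integral of \<open>b\<close> over a subinterval of \<open>[0, t]\<close> is at most \<open>t * Max |b|\<close>, whatever the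
  number of jumps.
\<close>

lemma weights_bounded:
  fixes b v :: "'n::finite \<Rightarrow> real"
  assumes "0 \<le> t"
  obtains C where "\<And>n y s. \<bar>weight_at_jump b v t n y s\<bar> \<le> C"
    and "\<And>n y s. \<bar>final_weight b v t n y s\<bar> \<le> C"
proof -
  define B where "B = Max (range (\<lambda>i. \<bar>b i\<bar>))"
  define V where "V = Max (range (\<lambda>i. \<bar>v i\<bar>))"
  have B: "\<bar>b i\<bar> \<le> B" for i unfolding B_def by (rule Max_ge) auto
  have V: "\<bar>v i\<bar> \<le> V" for i unfolding V_def by (rule Max_ge) auto
  have nonneg: "0 \<le> B" "0 \<le> V"
    using B[of undefined] V[of undefined] by auto
  have sum: "(\<Sum>k<n. b (y k) * s k) \<le> B * jump_time n s" if "reaches t n s" for n y s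
  proof -
    have "(\<Sum>k<n. b (y k) * s k) \<le> (\<Sum>k<n. B * s k)"
      using that B by (intro sum_mono mult_right_mono) (auto simp: reaches_def abs_le_iff)
    then show ?thesis by (simp add: jump_time_def sum_distrib_left)
  qed
  have mult: "\<bar>exp x * v i\<bar> \<le> exp (B * t) * V" if "x \<le> B * t" for x i
    using that V nonneg by (simp add: abs_mult mult_mono)
  have zero: "0 \<le> exp (B * t) * V" using nonneg by simp
  show ?thesis
  proof (rule that[of "exp (B * t) * V"])
    fix n y s
    show "\<bar>weight_at_jump b v t n y s\<bar> \<le> exp (B * t) * V"
    proof (cases "reaches t n s")
      case True
      have "B * jump_time n s \<le> B * t"
        using True nonneg by (intro mult_left_mono) (auto simp: reaches_def)
      then show ?thesis
        using True sum[OF True, of y] by (simp add: weight_at_jump_def mult)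
    qed (use zero in \<open>simp add: weight_at_jump_def\<close>)
    show "\<bar>final_weight b v t n y s\<bar> \<le> exp (B * t) * V"
    proof (cases "reaches t n s \<and> t < jump_time (Suc n) s")
      case True
      then have "b (y n) * (t - jump_time n s) \<le> B * (t - jump_time n s)"
        using B by (intro mult_right_mono) (auto simp: reaches_def abs_le_iff)
      then have "(\<Sum>k<n. b (y k) * s k) + b (y n) * (t - jump_time n s) \<le> B * t"
        using True sum[of n s y] by (simp add: algebra_simps)
      then show ?thesis using True by (simp only: final_weight_def mult simp_thms if_True)
    qed (use zero in \<open>simp only: final_weight_def simp_thms if_False abs_zero\<close>)
  qed
qed

lemma measurable_weights [measurable]:
  fixes b v :: "'n \<Rightarrow> real"
  shows "n \<le> m \<Longrightarrow> weight_at_jump b v t n y \<in> borel_measurable (PiM {..<m} (\<lambda>_. borel))"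
    and "n < m \<Longrightarrow> final_weight b v t n y \<in> borel_measurable (PiM {..<m} (\<lambda>_. borel))"
proof -
  have comp: "(\<lambda>s. s k) \<in> borel_measurable (PiM {..<m} (\<lambda>_. borel :: real measure))"
    if "k < m" for k
    using that by (intro measurable_component_singleton) auto
  have jump: "jump_time k \<in> borel_measurable (PiM {..<m} (\<lambda>_. borel))" if "k \<le> m" for k
    unfolding jump_time_def[abs_def] using that by (intro borel_measurable_sum comp) auto
  have reach: "Measurable.pred (PiM {..<m} (\<lambda>_. borel)) (reaches t k)" if "k \<le> m" for k
    unfolding reaches_def[abs_def]
    using that comp jump[OF that]
    by (intro pred_intros_logic pred_intros_finite) (auto intro: borel_measurable_pred_less)
  have sum: "(\<lambda>s. \<Sum>k<k. b (y k) * s k) \<in> borel_measurable (PiM {..<m} (\<lambda>_. borel))"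
    if "k \<le> m" for k
    using that by (intro borel_measurable_sum borel_measurable_times comp) auto
  show "weight_at_jump b v t n y \<in> borel_measurable (PiM {..<m} (\<lambda>_. borel))" if n: "n \<le> m"
    unfolding weight_at_jump_def[abs_def] using reach[OF n] sum[OF n] by measurable
  show "final_weight b v t n y \<in> borel_measurable (PiM {..<m} (\<lambda>_. borel))" if n: "n < m"
  proof -
    have "Suc n \<le> m" "n \<le> m" using n by auto
    note [measurable] = jump[OF this(1)] jump[OF this(2)] reach[OF this(2)] sum[OF this(2)]
    show ?thesis unfolding final_weight_def[abs_def] by measurable
  qed
qed

lemma weights_cong:
  assumes "\<And>k. k \<le> n \<Longrightarrow> y k = y' k"
  shows "(\<And>k. k < n \<Longrightarrow> s k = s' k) \<Longrightarrow> weight_at_jump b v t n y s = weight_at_jump b v t n y' s'"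
    and "(\<And>k. k \<le> n \<Longrightarrow> s k = s' k) \<Longrightarrow> final_weight b v t n y s = final_weight b v t n y' s'"
proof -
  have jump: "jump_time n s = jump_time n s'" if "\<And>k. k < n \<Longrightarrow> s k = s' k" for n s'
    unfolding jump_time_def using that by (intro sum.cong) auto
  have reach: "reaches t n s \<longleftrightarrow> reaches t n s'" if "\<And>k. k < n \<Longrightarrow> s k = s' k" for s'
    unfolding reaches_def using that jump[OF that] by auto
  have sum: "(\<Sum>k<n. b (y k) * s k) = (\<Sum>k<n. b (y' k) * s' k)"
    if "\<And>k. k < n \<Longrightarrow> s k = s' k" for s'
    using assms that by (intro sum.cong) auto
  show "weight_at_jump b v t n y s = weight_at_jump b v t n y' s'"
    if "\<And>k. k < n \<Longrightarrow> s k = s' k"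
    unfolding weight_at_jump_def using reach[OF that] sum[OF that] assms[of n] by simp
  show "final_weight b v t n y s = final_weight b v t n y' s'"
    if "\<And>k. k \<le> n \<Longrightarrow> s k = s' k"
    unfolding final_weight_def
    using reach[of s'] sum[of s'] jump[of n s'] jump[of "Suc n" s'] assms[of n] that by simp
qed

text \<open>
  Integrating over the holding time \<open>s n\<close> in state \<open>y n\<close> and averaging over the next state: what
  reaches the \<open>n\<close>-th jump either survives in that state until \<open>t\<close> or reaches the next jump.
\<close>

lemma weights_one_step:
  fixes b v :: "'n::finite \<Rightarrow> real"
  assumes l: "0 < l" and w: "l * (\<Sum>j\<in>UNIV. p j * v j) = (l - b (y n)) * v (y n)"
  shows "(\<integral>x. weight_at_jump b v t n y s - final_weight b v t n y (s(n := x)) -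
      (\<Sum>j\<in>UNIV. p j * weight_at_jump b v t (Suc n) (y(Suc n := j)) (s(n := x)))
      \<partial>exponential_law l) = 0"
proof (cases "reaches t n s")
  case False
  have nr: "\<not> reaches t n (s(n := x))" "\<not> reaches t (Suc n) (s(n := x))" for x
    using False by (auto simp: reaches_def jump_time_def Ball_def less_Suc_eq)
  show ?thesis
    using False nr by (simp add: weight_at_jump_def final_weight_def)
next
  case True
  define R where "R = t - jump_time n s"
  define C where "C = exp (\<Sum>k<n. b (y k) * s k)"
  have R: "0 \<le> R" using True by (simp add: R_def reaches_def)
  have 1: "weight_at_jump b v t n y s = C * v (y n)"
    using True by (simp add: weight_at_jump_def C_def)
  have 2: "final_weight b v t n y (s(n := x)) =
      C * (if R < x then exp (b (y n) * R) * v (y n) else 0)" for x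
    using True by (auto simp: final_weight_def reaches_def jump_time_def C_def R_def exp_add)
  have 3: "weight_at_jump b v t (Suc n) (y(Suc n := j)) (s(n := x)) =
      C * (if 0 \<le> x \<and> x \<le> R then exp (b (y n) * x) * v j else 0)" for x j
    using True
    by (auto simp: weight_at_jump_def reaches_def jump_time_def C_def R_def exp_add
        Ball_def less_Suc_eq)
  have sum: "(\<Sum>j\<in>UNIV. p j * weight_at_jump b v t (Suc n) (y(Suc n := j)) (s(n := x))) =
      C * (if 0 \<le> x \<and> x \<le> R then exp (b (y n) * x) * (\<Sum>j\<in>UNIV. p j * v j) else 0)" for x
    unfolding 3 by (cases "0 \<le> x \<and> x \<le> R") (auto simp: sum_distrib_left mult_ac)
  have "(\<integral>x. C * (v (y n) - (if R < x then exp (b (y n) * R) * v (y n) else 0) -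
      (if 0 \<le> x \<and> x \<le> R then exp (b (y n) * x) * (\<Sum>j\<in>UNIV. p j * v j) else 0))
      \<partial>exponential_law l) = 0"
    using exponential_law_one_step[OF l R w] by simp
  then show ?thesis unfolding 1 2 sum by (simp add: right_diff_distrib)
qed


section \<open>The law of the holding times\<close>

text \<open>
  The jump chain \<open>Y\<close> and the holding times \<open>S\<close> behind a Markov jump process \<open>X\<close>, kept as
  parameters so that path events and jump times can be named.
\<close>

locale jump_construction = jump_rates lam q + prob_space M
  for lam :: "'n::finite \<Rightarrow> real" and q :: "real ^ 'n ^ 'n" and M :: "'w measure" +
  fixes X :: "real \<Rightarrow> 'w \<Rightarrow> 'n" and Y :: "nat \<Rightarrow> 'w \<Rightarrow> 'n" and S :: "nat \<Rightarrow> 'w \<Rightarrow> real"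
  assumes measurable_Y [measurable]: "Y n \<in> M \<rightarrow>\<^sub>M count_space UNIV"
    and measurable_S [measurable]: "S n \<in> borel_measurable M"
    and S_pos: "\<omega> \<in> space M \<Longrightarrow> 0 < S n \<omega>"
    and X_eq: "\<omega> \<in> space M \<Longrightarrow> 0 \<le> t \<Longrightarrow>
      \<exists>n. (\<Sum>k<n. S k \<omega>) \<le> t \<and> t < (\<Sum>k<Suc n. S k \<omega>) \<and> X t \<omega> = Y n \<omega>"
    and law: "\<And>n i t. (\<And>k. 0 \<le> t k) \<Longrightarrow>
      measure M {\<omega>\<in>space M. \<forall>k\<le>n. Y k \<omega> = i k \<and> t k < S k \<omega>} =
      measure M {\<omega>\<in>space M. Y 0 \<omega> = i 0} *
      (\<Prod>k<n. q $ i k $ i (Suc k)) * (\<Prod>k\<le>n. exp (- lam (i k) * t k))"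
begin

definition path_event :: "(nat \<Rightarrow> 'n) \<Rightarrow> nat \<Rightarrow> 'w set" where
  "path_event p n = {\<omega>\<in>space M. \<forall>k\<le>n. Y k \<omega> = p k}"

lemma sets_path_event [measurable]: "path_event p n \<in> events"
  unfolding path_event_def by measurable

lemma prob_path_event:
  "prob (path_event p n) = prob {\<omega>\<in>space M. Y 0 \<omega> = p 0} * (\<Prod>k<n. q $ p k $ p (Suc k))"
proof -
  have "path_event p n = {\<omega>\<in>space M. \<forall>k\<le>n. Y k \<omega> = p k \<and> 0 < S k \<omega>}"
    using S_pos by (auto simp: path_event_def)
  then show ?thesis using law[of "\<lambda>_. 0" n p] by simp
qed

text \<open>
  Coordinates outside \<open>I\<close> are left unrestricted by taking the threshold \<open>0\<close>, which the positive
  holding times always exceed.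
\<close>

lemma prob_path_event_tails:
  assumes "\<And>k. k \<in> I \<Longrightarrow> 0 \<le> t k" and "I \<subseteq> {..n}"
  shows "prob {\<omega>\<in>path_event p n. \<forall>k\<in>I. t k < S k \<omega>} =
    prob (path_event p n) * (\<Prod>k\<in>I. exp (- lam (p k) * t k))"
proof -
  define t' where "t' k = (if k \<in> I then t k else 0)" for k
  have "{\<omega>\<in>path_event p n. \<forall>k\<in>I. t k < S k \<omega>} =
      {\<omega>\<in>space M. \<forall>k\<le>n. Y k \<omega> = p k \<and> t' k < S k \<omega>}"
    using S_pos assms(2) by (auto simp: path_event_def t'_def)
  then have "prob {\<omega>\<in>path_event p n. \<forall>k\<in>I. t k < S k \<omega>} =
      prob (path_event p n) * (\<Prod>k\<le>n. exp (- lam (p k) * t' k))"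
    using law[of t' n p] assms(1) by (simp add: prob_path_event t'_def)
  also have "(\<Prod>k\<le>n. exp (- lam (p k) * t' k)) = (\<Prod>k\<in>I. exp (- lam (p k) * t k))"
    by (rule prod.mono_neutral_cong_right) (use assms(2) in \<open>auto simp: t'_def\<close>)
  finally show ?thesis .
qed

text \<open>
  Given the path of the jump chain, the holding times are independent exponential variables.  The
  definition of the process only provides joint tail probabilities; the half-lines
  \<open>{c<..}\<close> generate the Borel sets and are stable under intersection, so this determines the
  joint law.
\<close>

lemma holding_times_law:
  assumes n: "n \<le> m" and pos: "prob (path_event p m) \<noteq> 0"
  shows "distr (uniform_measure M (path_event p m)) (PiM {..<Suc n} (\<lambda>_. borel))
      (\<lambda>\<omega>. \<lambda>k\<in>{..<Suc n}. S k \<omega>) = PiM {..<Suc n} (\<lambda>k. exponential_law (lam (p k)))"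
proof -
  define N where "N = uniform_measure M (path_event p m)"
  have E: "emeasure M (path_event p m) \<noteq> 0" "emeasure M (path_event p m) \<noteq> \<infinity>"
    using pos by (auto simp: emeasure_eq_measure)
  interpret N: prob_space N
    unfolding N_def by (rule prob_space_uniform_measure[OF E])
  have sets_N [measurable_cong, simp]: "sets N = sets M" by (simp add: N_def)
  have space_N [simp]: "space N = space M" by (simp add: N_def)
  have S_N: "S k \<in> borel_measurable N" for k using measurable_S[of k] by measurable
  have tails: "N.prob {\<omega>\<in>space M. \<forall>k\<in>I. t k < S k \<omega>} = (\<Prod>k\<in>I. exp (- lam (p k) * t k))"
    if "\<And>k. k \<in> I \<Longrightarrow> 0 \<le> t k" "I \<subseteq> {..<Suc n}" for t I
  proof -
    have I: "I \<subseteq> {..m}" "finite I" using that(2) n by (auto intro: finite_subset)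
    have "{\<omega>\<in>space M. \<forall>k\<in>I. t k < S k \<omega>} \<in> sets M"
      by measurable
    moreover have "path_event p m \<inter> {\<omega>\<in>space M. \<forall>k\<in>I. t k < S k \<omega>} =
        {\<omega>\<in>path_event p m. \<forall>k\<in>I. t k < S k \<omega>}"
      by (auto simp: path_event_def)
    ultimately show ?thesis
      using pos E I prob_path_event_tails[of I t m p] that(1) by (simp add: N_def)
  qed
  have marginal: "distr N borel (S k) = exponential_law (lam (p k))" if "k < Suc n" for k
  proof -
    have "N.prob {\<omega>\<in>space N. S k \<omega> \<le> t} = 1 - exp (- t * lam (p k))" if "0 \<le> t" for t
    proof -
      have "N.prob {\<omega>\<in>space N. S k \<omega> \<le> t} = 1 - N.prob {\<omega>\<in>space N. t < S k \<omega>}"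
        using N.prob_neg[of "\<lambda>\<omega>. t < S k \<omega>"] S_N[of k] by (simp add: not_less)
      then show ?thesis
        using tails[of "{k}" "\<lambda>_. t"] that \<open>k < Suc n\<close> by (simp add: mult.commute)
    qed
    then have "distributed N lborel (S k) (exponential_density (lam (p k)))"
      using S_N N.exponential_distributed_iff[OF lam_pos] by blast
    then have "distr N lborel (S k) = exponential_law (lam (p k))"
      unfolding exponential_law_def by (rule distributed_distr_eq_density)
    then show ?thesis by (metis distr_cong sets_lborel)
  qed
  have "N.indep_vars (\<lambda>_. borel) S {..<Suc n}"
  proof (subst N.indep_vars_finite[where E = "\<lambda>_. insert UNIV (range greaterThan)"])
    show "sets (borel :: real measure) =
        sigma_sets (space borel) (insert UNIV (range greaterThan))"
    proof -
      have "sets (borel :: real measure) = sigma_sets UNIV (range greaterThan)"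
        by (subst borel_Ioi) simp
      also have "\<dots> = sigma_sets UNIV (insert UNIV (range greaterThan))"
        by (rule sigma_sets_eqI) (auto intro: sigma_sets.Basic sigma_sets_top)
      finally show ?thesis by simp
    qed
    show "Int_stable (insert UNIV (range greaterThan) :: real set set)"
    proof -
      have "{a<..} \<inter> {b<..} = {max a b<..}" for a b :: real by auto
      then show ?thesis by (auto simp: Int_stable_def)
    qed
    show "\<forall>A\<in>(\<Pi> i\<in>{..<Suc n}. insert UNIV (range greaterThan)).
        N.prob (\<Inter>j\<in>{..<Suc n}. S j -` A j \<inter> space N) =
        (\<Prod>j\<in>{..<Suc n}. N.prob (S j -` A j \<inter> space N))"
    proof
      fix A :: "nat \<Rightarrow> real set"
      assume A: "A \<in> (\<Pi> i\<in>{..<Suc n}. insert UNIV (range greaterThan))"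
      \<comment> \<open>A half-line with a negative threshold, or the whole line, contains every positive number,
        as does \<open>{0<..}\<close>.\<close>
      have "\<exists>c. 0 \<le> c \<and> (\<forall>x>0. x \<in> A k \<longleftrightarrow> c < x)" if "k < Suc n" for k
      proof -
        have "A k = UNIV \<or> (\<exists>c. A k = {c<..})" using A that by (auto simp: Pi_iff)
        then show ?thesis
        proof (elim disjE exE)
          fix c assume "A k = {c<..}"
          then show ?thesis by (intro exI[of _ "max 0 c"]) auto
        qed auto
      qed
      then obtain c where c: "\<And>k. k < Suc n \<Longrightarrow> 0 \<le> c k"
        "\<And>k x. k < Suc n \<Longrightarrow> 0 < x \<Longrightarrow> x \<in> A k \<longleftrightarrow> c k < x"
        by metis
      have "(\<Inter>j\<in>{..<Suc n}. S j -` A j \<inter> space N) =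
          {\<omega>\<in>space M. \<forall>k\<in>{..<Suc n}. c k < S k \<omega>}"
        using c(2) S_pos by auto
      then have 1: "N.prob (\<Inter>j\<in>{..<Suc n}. S j -` A j \<inter> space N) =
          (\<Prod>k<Suc n. exp (- lam (p k) * c k))"
        using tails[of "{..<Suc n}" c] c(1) by simp
      have 2: "N.prob (S j -` A j \<inter> space N) = exp (- lam (p j) * c j)" if "j < Suc n" for j
      proof -
        have "S j -` A j \<inter> space N = {\<omega>\<in>space M. \<forall>k\<in>{j}. c k < S k \<omega>}"
          using c(2) S_pos that by auto
        then show ?thesis using tails[of "{j}" c] c(1) that by simp
      qed
      show "N.prob (\<Inter>j\<in>{..<Suc n}. S j -` A j \<inter> space N) =
          (\<Prod>j\<in>{..<Suc n}. N.prob (S j -` A j \<inter> space N))"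
        unfolding 1 by (rule prod.cong[OF refl], rule 2[symmetric]) simp
    qed
  qed (use S_N in auto)
  then have "distr N (PiM {..<Suc n} (\<lambda>_. borel)) (\<lambda>\<omega>. \<lambda>k\<in>{..<Suc n}. S k \<omega>) =
      PiM {..<Suc n} (\<lambda>k. distr N borel (S k))"
    by (subst (asm) N.indep_vars_iff_distr_eq_PiM) (use S_N in auto)
  also have "\<dots> = PiM {..<Suc n} (\<lambda>k. exponential_law (lam (p k)))"
    by (rule PiM_cong) (simp_all add: marginal)
  finally show ?thesis by (simp add: N_def)
qed

lemma integral_over_path:
  assumes n: "n \<le> m" and g: "g \<in> borel_measurable (PiM {..<Suc n} (\<lambda>_. borel))"
  shows "(\<integral>\<omega>. indicator (path_event p m) \<omega> * (g (\<lambda>k\<in>{..<Suc n}. S k \<omega>) :: real) \<partial>M) =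
    prob (path_event p m) * integral\<^sup>L (PiM {..<Suc n} (\<lambda>k. exponential_law (lam (p k)))) g"
proof (cases "prob (path_event p m) = 0")
  case True
  then have "AE \<omega> in M. \<omega> \<notin> path_event p m"
    by (intro AE_not_in) (auto simp: null_sets_def emeasure_eq_measure)
  then have "(\<integral>\<omega>. indicator (path_event p m) \<omega> * (g (\<lambda>k\<in>{..<Suc n}. S k \<omega>) :: real) \<partial>M) = 0"
    by (intro integral_eq_zero_AE) (auto split: split_indicator)
  with True show ?thesis by simp
next
  case False
  let ?f = "\<lambda>\<omega>. \<lambda>k\<in>{..<Suc n}. S k \<omega>"
  have f: "?f \<in> M \<rightarrow>\<^sub>M PiM {..<Suc n} (\<lambda>_. borel)"
    by (intro measurable_restrict measurable_S)
  have "integral\<^sup>L (PiM {..<Suc n} (\<lambda>k. exponential_law (lam (p k)))) g =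
      integral\<^sup>L (uniform_measure M (path_event p m)) (\<lambda>\<omega>. g (?f \<omega>))"
    unfolding holding_times_law[OF n False, symmetric]
    using f g by (subst integral_distr) auto
  also have "\<dots> = (\<integral>\<omega>. indicator (path_event p m) \<omega> * g (?f \<omega>) \<partial>M) / prob (path_event p m)"
    using False measurable_compose[OF f g]
    by (intro integral_uniform_measure) (auto simp: emeasure_eq_measure)
  finally show ?thesis using False by simp
qed

lemma indicator_path_event_split:
  assumes "\<omega> \<in> space M"
  shows "(indicator (path_event p n) \<omega> :: real) =
    (\<Sum>j\<in>UNIV. indicator (path_event (p(Suc n := j)) (Suc n)) \<omega>)"
proof -
  have "(indicator (path_event (p(Suc n := j)) (Suc n)) \<omega> :: real) =
      (if j = Y (Suc n) \<omega> then indicator (path_event p n) \<omega> else 0)" for j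
    using assms by (auto simp: path_event_def le_Suc_eq split: split_indicator)
  then show ?thesis by simp
qed

lemma integral_path_event_split:
  fixes h :: "'w \<Rightarrow> real"
  assumes "integrable M h"
  shows "(\<integral>\<omega>. indicator (path_event p n) \<omega> * h \<omega> \<partial>M) =
    (\<Sum>j\<in>UNIV. \<integral>\<omega>. indicator (path_event (p(Suc n := j)) (Suc n)) \<omega> * h \<omega> \<partial>M)"
proof -
  have "(\<integral>\<omega>. indicator (path_event p n) \<omega> * h \<omega> \<partial>M) =
      (\<integral>\<omega>. (\<Sum>j\<in>UNIV. indicator (path_event (p(Suc n := j)) (Suc n)) \<omega> * h \<omega>) \<partial>M)"
    by (intro Bochner_Integration.integral_cong refl)
      (simp add: indicator_path_event_split sum_distrib_right)
  also have "\<dots> = (\<Sum>j\<in>UNIV. \<integral>\<omega>. indicator (path_event (p(Suc n := j)) (Suc n)) \<omega> * h \<omega> \<partial>M)"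
    using integrable_mult_indicator[OF sets_path_event assms]
    by (intro Bochner_Integration.integral_sum) simp
  finally show ?thesis .
qed

text \<open>
  An event about the first \<open>m\<close> states is a disjoint union of events about the first \<open>m + 1\<close>, so
  a vanishing integral over all long paths passes down to paths of length \<open>0\<close>.
\<close>

lemma integral_initial_state_zero:
  fixes h :: "'w \<Rightarrow> real"
  assumes h: "integrable M h"
    and zero: "\<And>p. (\<integral>\<omega>. indicator (path_event p n) \<omega> * h \<omega> \<partial>M) = 0"
  shows "(\<integral>\<omega>. indicator {\<omega>\<in>space M. Y 0 \<omega> = i} \<omega> * h \<omega> \<partial>M) = 0"
proof -
  have "\<forall>p. (\<integral>\<omega>. indicator (path_event p 0) \<omega> * h \<omega> \<partial>M) = 0"
  proof (rule inc_induct[of 0 n])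
    fix m assume "\<forall>p. (\<integral>\<omega>. indicator (path_event p (Suc m)) \<omega> * h \<omega> \<partial>M) = 0"
    then show "\<forall>p. (\<integral>\<omega>. indicator (path_event p m) \<omega> * h \<omega> \<partial>M) = 0"
      by (subst integral_path_event_split[OF h]) simp
  qed (use zero in auto)
  then have "(\<integral>\<omega>. indicator (path_event (\<lambda>_. i) 0) \<omega> * h \<omega> \<partial>M) = 0" ..
  then show ?thesis by (simp add: path_event_def)
qed

lemma measurable_weights_path [measurable]:
  fixes b v :: "'n \<Rightarrow> real"
  shows "(\<lambda>\<omega>. weight_at_jump b v t n (\<lambda>k. Y k \<omega>) (\<lambda>k. S k \<omega>)) \<in> borel_measurable M"
    and "(\<lambda>\<omega>. final_weight b v t n (\<lambda>k. Y k \<omega>) (\<lambda>k. S k \<omega>)) \<in> borel_measurable M"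
proof -
  have [measurable]: "(\<lambda>\<omega>. f (Y k \<omega>)) \<in> borel_measurable M" for f :: "'n \<Rightarrow> real" and k
    by (rule measurable_compose[OF measurable_Y]) simp
  show "(\<lambda>\<omega>. weight_at_jump b v t n (\<lambda>k. Y k \<omega>) (\<lambda>k. S k \<omega>)) \<in> borel_measurable M"
    and "(\<lambda>\<omega>. final_weight b v t n (\<lambda>k. Y k \<omega>) (\<lambda>k. S k \<omega>)) \<in> borel_measurable M"
    unfolding weight_at_jump_def final_weight_def reaches_def jump_time_def by measurable
qed

text \<open>
  On a path of \<open>n\<close> jumps, split according to the next state \<open>j\<close>.  By the law of the holding times
  each piece is an integral over a product of exponential laws, and these products agree for all
  \<open>j\<close>, so the pieces combine into one integral.  Integrating the last holding time
  first gives zero.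
\<close>

lemma weights_one_step_on_path:
  fixes b v :: "'n \<Rightarrow> real"
  assumes t: "0 \<le> t"
    and v: "\<And>i. lam i * (\<Sum>j\<in>UNIV. q $ i $ j * v j) = (lam i - b i) * v i"
  shows "(\<integral>\<omega>. indicator (path_event p n) \<omega> *
      (weight_at_jump b v t n (\<lambda>k. Y k \<omega>) (\<lambda>k. S k \<omega>) -
       final_weight b v t n (\<lambda>k. Y k \<omega>) (\<lambda>k. S k \<omega>) -
       weight_at_jump b v t (Suc n) (\<lambda>k. Y k \<omega>) (\<lambda>k. S k \<omega>)) \<partial>M) = 0"
    (is "(\<integral>\<omega>. _ * ?h \<omega> \<partial>M) = 0")
proof -
  obtain C where C: "\<And>n y s. \<bar>weight_at_jump b v t n y s\<bar> \<le> C"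
    "\<And>n y s. \<bar>final_weight b v t n y s\<bar> \<le> C"
    using weights_bounded[OF t] by metis
  define I where "I = {..<Suc n}"
  define p' where "p' j = p(Suc n := j)" for j
  define g where "g j s = weight_at_jump b v t n p s - final_weight b v t n p s -
    weight_at_jump b v t (Suc n) (p' j) s" for j s
  define P where "P = PiM I (\<lambda>k. exponential_law (lam (p k)))"
  interpret E: prob_space "exponential_law (lam (p k))" for k
    by (rule prob_space_exponential_law[OF lam_pos])
  interpret E: product_prob_space "\<lambda>k. exponential_law (lam (p k))" I ..
  have sets_P: "sets P = sets (PiM I (\<lambda>_. borel))"
    unfolding P_def by (rule sets_PiM_cong) simp_all
  have g_meas: "g j \<in> borel_measurable (PiM I (\<lambda>_. borel))" for j
    unfolding g_def[abs_def] I_def by (intro borel_measurable_diff measurable_weights) auto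
  have g_int: "integrable P (g j)" for j
  proof -
    interpret P: prob_space P unfolding P_def by (rule E.prob_space_axioms)
    have "\<bar>g j s\<bar> \<le> 3 * C" for s
      using C(1)[of n p s] C(2)[of n p s] C(1)[of "Suc n" "p' j" s] by (simp add: g_def)
    then show ?thesis
      using g_meas sets_P by (intro P.integrable_const_bound[of _ "3 * C"])
        (auto cong: measurable_cong_sets)
  qed
  have h_int: "integrable M ?h"
  proof (rule integrable_const_bound[of _ "3 * C"])
    show "AE \<omega> in M. norm (?h \<omega>) \<le> 3 * C"
    proof (rule AE_I2)
      fix \<omega>
      show "norm (?h \<omega>) \<le> 3 * C"
        using C(1)[of n "\<lambda>k. Y k \<omega>" "\<lambda>k. S k \<omega>"] C(2)[of n "\<lambda>k. Y k \<omega>" "\<lambda>k. S k \<omega>"]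
          C(1)[of "Suc n" "\<lambda>k. Y k \<omega>" "\<lambda>k. S k \<omega>"] by simp
    qed
  qed (intro borel_measurable_diff measurable_weights_path)
  have on_path: "(\<integral>\<omega>. indicator (path_event (p' j) (Suc n)) \<omega> * ?h \<omega> \<partial>M) =
      prob (path_event p n) * (q $ p n $ j * integral\<^sup>L P (g j))" for j
  proof -
    have "(\<integral>\<omega>. indicator (path_event (p' j) (Suc n)) \<omega> * ?h \<omega> \<partial>M) =
        (\<integral>\<omega>. indicator (path_event (p' j) (Suc n)) \<omega> * g j (\<lambda>k\<in>I. S k \<omega>) \<partial>M)"
    proof (intro Bochner_Integration.integral_cong refl)
      fix \<omega> assume "\<omega> \<in> space M"
      show "indicator (path_event (p' j) (Suc n)) \<omega> * ?h \<omega> =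
          indicator (path_event (p' j) (Suc n)) \<omega> * g j (\<lambda>k\<in>I. S k \<omega>)"
      proof (cases "\<omega> \<in> path_event (p' j) (Suc n)")
        case True
        then have Y: "Y k \<omega> = p' j k" if "k \<le> Suc n" for k
          using that by (auto simp: path_event_def)
        then have Yp: "Y k \<omega> = p k" if "k \<le> n" for k
          using that Y[of k] by (simp add: p'_def)
        have "?h \<omega> = g j (\<lambda>k\<in>I. S k \<omega>)"
          unfolding g_def
          by (intro arg_cong2[where f = "(-)"] weights_cong) (use Y Yp in \<open>auto simp: I_def\<close>)
        then show ?thesis by simp
      qed simp
    qed
    also have "\<dots> = prob (path_event (p' j) (Suc n)) *
        integral\<^sup>L (PiM I (\<lambda>k. exponential_law (lam (p' j k)))) (g j)"
      unfolding I_def by (rule integral_over_path) (use g_meas in \<open>simp_all add: I_def\<close>)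
    also have "PiM I (\<lambda>k. exponential_law (lam (p' j k))) = P"
      unfolding P_def by (rule PiM_cong) (auto simp: p'_def I_def)
    also have "prob (path_event (p' j) (Suc n)) = prob (path_event p n) * q $ p n $ j"
      by (simp add: prob_path_event p'_def)
    finally show ?thesis by simp
  qed
  have sum_g: "(\<Sum>j\<in>UNIV. q $ p n $ j * g j s) = weight_at_jump b v t n p s -
      final_weight b v t n p s - (\<Sum>j\<in>UNIV. q $ p n $ j * weight_at_jump b v t (Suc n) (p' j) s)"
    for s
    by (simp add: g_def right_diff_distrib sum_subtractf q_row flip: sum_distrib_right)
  \<comment> \<open>Fubini: the holding time in the current state \<open>p n\<close> becomes the inner integration.\<close>
  have "(\<Sum>j\<in>UNIV. q $ p n $ j * integral\<^sup>L P (g j)) = (\<integral>s. (\<Sum>j\<in>UNIV. q $ p n $ j * g j s) \<partial>P)"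
    using g_int by (subst Bochner_Integration.integral_sum) auto
  also have "\<dots> = (\<integral>s. (\<integral>x. (\<Sum>j\<in>UNIV. q $ p n $ j * g j (s(n := x)))
      \<partial>exponential_law (lam (p n))) \<partial>PiM {..<n} (\<lambda>k. exponential_law (lam (p k))))"
  proof -
    have I: "I = insert n {..<n}" by (auto simp: I_def)
    have "integrable P (\<lambda>s. \<Sum>j\<in>UNIV. q $ p n $ j * g j s)"
      using g_int by auto
    then show ?thesis
      unfolding P_def I by (intro E.product_integral_insert) auto
  qed
  also have "\<dots> = 0"
  proof -
    have "(\<integral>x. (\<Sum>j\<in>UNIV. q $ p n $ j * g j (s(n := x))) \<partial>exponential_law (lam (p n))) = 0" for s
    proof -
      have "weight_at_jump b v t n p (s(n := x)) = weight_at_jump b v t n p s" for x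
        by (rule weights_cong) auto
      then show ?thesis
        unfolding sum_g p'_def
        using weights_one_step[where p = "\<lambda>j. q $ p n $ j" and b = b and v = v and y = p
            and n = n and s = s and t = t, OF lam_pos v[of "p n"]]
        by simp
    qed
    then show ?thesis by simp
  qed
  finally have zero: "(\<Sum>j\<in>UNIV. q $ p n $ j * integral\<^sup>L P (g j)) = 0" .
  have "(\<integral>\<omega>. indicator (path_event p n) \<omega> * ?h \<omega> \<partial>M) =
      (\<Sum>j\<in>UNIV. \<integral>\<omega>. indicator (path_event (p' j) (Suc n)) \<omega> * ?h \<omega> \<partial>M)"
    unfolding p'_def by (rule integral_path_event_split[OF h_int])
  also have "\<dots> = (\<Sum>j\<in>UNIV. prob (path_event p n) * (q $ p n $ j * integral\<^sup>L P (g j)))"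
    by (rule sum.cong[OF refl on_path])
  also have "\<dots> = prob (path_event p n) * (\<Sum>j\<in>UNIV. q $ p n $ j * integral\<^sup>L P (g j))"
    by (rule sum_distrib_left[symmetric])
  also have "\<dots> = 0" unfolding zero by (rule mult_zero_right)
  finally show ?thesis .
qed

end


section \<open>The Feynman-Kac formula\<close>

context jump_construction
begin

definition jumps :: "real \<Rightarrow> 'w \<Rightarrow> nat" where
  "jumps t \<omega> = (LEAST n. t < jump_time (Suc n) (\<lambda>k. S k \<omega>))"

text \<open>
  The integral of \<open>b\<close> along the path up to time \<open>t\<close>, written through the jumps so that
  measurability is evident and no integral over time remains.
\<close>

definition additive_functional :: "('n \<Rightarrow> real) \<Rightarrow> real \<Rightarrow> 'w \<Rightarrow> real" where
  "additive_functional b t \<omega> = (\<Sum>k<jumps t \<omega>. b (Y k \<omega>) * S k \<omega>) +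
    b (Y (jumps t \<omega>) \<omega>) * (t - jump_time (jumps t \<omega>) (\<lambda>k. S k \<omega>))"

lemma jump_time_mono:
  assumes "\<omega> \<in> space M" and "m \<le> n"
  shows "jump_time m (\<lambda>k. S k \<omega>) \<le> jump_time n (\<lambda>k. S k \<omega>)"
  unfolding jump_time_def
  by (rule sum_mono2) (use assms S_pos in \<open>auto intro: less_imp_le\<close>)

lemma jumps_eqI:
  assumes \<omega>: "\<omega> \<in> space M" and n: "jump_time n (\<lambda>k. S k \<omega>) \<le> t"
    "t < jump_time (Suc n) (\<lambda>k. S k \<omega>)"
  shows "jumps t \<omega> = n"
  unfolding jumps_def
proof (rule Least_equality)
  fix m assume m: "t < jump_time (Suc m) (\<lambda>k. S k \<omega>)"
  show "n \<le> m"
  proof (rule ccontr)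
    assume "\<not> n \<le> m"
    then have "jump_time (Suc m) (\<lambda>k. S k \<omega>) \<le> jump_time n (\<lambda>k. S k \<omega>)"
      by (intro jump_time_mono[OF \<omega>]) auto
    with m n show False by simp
  qed
qed (rule n)

lemma jumps_bounds:
  assumes "\<omega> \<in> space M" and "0 \<le> t"
  shows "jump_time (jumps t \<omega>) (\<lambda>k. S k \<omega>) \<le> t"
    and "t < jump_time (Suc (jumps t \<omega>)) (\<lambda>k. S k \<omega>)"
    and "X t \<omega> = Y (jumps t \<omega>) \<omega>"
proof -
  obtain n where n: "jump_time n (\<lambda>k. S k \<omega>) \<le> t" "t < jump_time (Suc n) (\<lambda>k. S k \<omega>)"
    "X t \<omega> = Y n \<omega>"
    using X_eq[OF assms] by (auto simp: jump_time_def)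
  have "jumps t \<omega> = n" by (rule jumps_eqI[OF assms(1) n(1,2)])
  with n show "jump_time (jumps t \<omega>) (\<lambda>k. S k \<omega>) \<le> t"
    "t < jump_time (Suc (jumps t \<omega>)) (\<lambda>k. S k \<omega>)" "X t \<omega> = Y (jumps t \<omega>) \<omega>"
    by simp_all
qed

lemma initial_state: "\<omega> \<in> space M \<Longrightarrow> X 0 \<omega> = Y 0 \<omega>"
  using jumps_eqI[of \<omega> 0 0] jumps_bounds(3)[of \<omega> 0] S_pos[of \<omega> 0] by (simp add: jump_time_def)

lemma reaches_iff:
  assumes "\<omega> \<in> space M" and "0 \<le> t"
  shows "reaches t n (\<lambda>k. S k \<omega>) \<longleftrightarrow> n \<le> jumps t \<omega>"
proof
  assume "n \<le> jumps t \<omega>"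
  then have "jump_time n (\<lambda>k. S k \<omega>) \<le> t"
    using jump_time_mono[OF assms(1)] jumps_bounds(1)[OF assms] by (meson order_trans)
  then show "reaches t n (\<lambda>k. S k \<omega>)"
    using S_pos[OF assms(1)] by (auto simp: reaches_def intro: less_imp_le)
next
  assume r: "reaches t n (\<lambda>k. S k \<omega>)"
  show "n \<le> jumps t \<omega>"
  proof (rule ccontr)
    assume "\<not> n \<le> jumps t \<omega>"
    then have "jump_time (Suc (jumps t \<omega>)) (\<lambda>k. S k \<omega>) \<le> jump_time n (\<lambda>k. S k \<omega>)"
      by (intro jump_time_mono[OF assms(1)]) auto
    with r jumps_bounds(2)[OF assms] show False by (simp add: reaches_def)
  qed
qed

lemma final_weight_eq:
  assumes "\<omega> \<in> space M" and "0 \<le> t"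
  shows "final_weight b v t n (\<lambda>k. Y k \<omega>) (\<lambda>k. S k \<omega>) =
    (if n = jumps t \<omega> then exp (additive_functional b t \<omega>) * v (X t \<omega>) else 0)"
proof (cases "n = jumps t \<omega>")
  case True
  then show ?thesis
    using reaches_iff[OF assms, of n] jumps_bounds[OF assms]
    by (simp add: final_weight_def additive_functional_def)
next
  case False
  then have "\<not> (reaches t n (\<lambda>k. S k \<omega>) \<and> t < jump_time (Suc n) (\<lambda>k. S k \<omega>))"
    using jumps_eqI[OF assms(1), of n t] by (auto simp: reaches_def)
  with False show ?thesis by (simp only: final_weight_def if_False)
qed

text \<open>
  Up to time \<open>t\<close> the integrand is a finite sum of multiples of indicators of the intervals between
  jumps.
\<close>

lemma integral_along_path:
  assumes \<omega>: "\<omega> \<in> space M" and t: "0 \<le> t"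
  shows "(LBINT u:{0..t}. b (X u \<omega>)) = additive_functional b t \<omega>"
proof -
  define N where "N = jumps t \<omega>"
  define T where "T n = jump_time n (\<lambda>k. S k \<omega>)" for n
  have mono: "T m \<le> T n" if "m \<le> n" for m n
    unfolding T_def by (rule jump_time_mono[OF \<omega> that])
  have T0: "0 \<le> T n" for n using mono[of 0 n] by (simp add: T_def jump_time_def)
  have N: "T N \<le> t" using jumps_bounds(1)[OF \<omega> t] by (simp add: N_def T_def)
  have "indicator {0..t} u * b (X u \<omega>) =
      (\<Sum>k<N. b (Y k \<omega>) * indicator {T k..<T (Suc k)} u) + b (Y N \<omega>) * indicator {T N..t} u" for u
  proof (cases "0 \<le> u \<and> u \<le> t")
    case True
    then have u: "0 \<le> u" "u \<le> t" by auto
    define n where "n = jumps u \<omega>"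
    have n: "T n \<le> u" "u < T (Suc n)" "X u \<omega> = Y n \<omega>"
      using jumps_bounds[OF \<omega> u(1)] by (simp_all add: n_def T_def)
    have nk: "T k \<le> u \<Longrightarrow> u < T (Suc k) \<Longrightarrow> k = n" for k
      using jumps_eqI[OF \<omega>, of k u] by (simp add: n_def T_def)
    have "n \<le> N"
    proof (rule ccontr)
      assume "\<not> n \<le> N"
      then have "T (Suc N) \<le> T n" by (intro mono) auto
      then show False using jumps_bounds(2)[OF \<omega> t] n(1) u(2) by (simp add: N_def T_def)
    qed
    have ind: "b (Y k \<omega>) * indicator {T k..<T (Suc k)} u = (if k = n then b (Y n \<omega>) else 0)" for k
    proof (cases "k = n")
      case False
      then have "u \<notin> {T k..<T (Suc k)}" using nk[of k] by auto
      with False show ?thesis by simp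
    qed (use n(1,2) in simp)
    have last: "b (Y N \<omega>) * indicator {T N..t} u = (if N = n then b (Y n \<omega>) else 0)"
    proof (cases "N = n")
      case False
      then have "T (Suc n) \<le> T N" using \<open>n \<le> N\<close> by (intro mono) auto
      then have "u \<notin> {T N..t}" using n(2) by simp
      with False show ?thesis by simp
    qed (use n(1) u in simp)
    have "(\<Sum>k<N. b (Y k \<omega>) * indicator {T k..<T (Suc k)} u) = (if n < N then b (Y n \<omega>) else 0)"
      unfolding ind by simp
    then show ?thesis
      unfolding last using u n(3) \<open>n \<le> N\<close> by simp
  next
    case False
    have "u \<notin> {T k..<T (Suc k)}" if "k < N" for k
      using False T0[of k] mono[of "Suc k" N] N that by auto
    moreover have "u \<notin> {T N..t}" using False T0[of N] by auto
    ultimately show ?thesis using False by auto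
  qed
  then have "(LBINT u:{0..t}. b (X u \<omega>)) =
      (\<integral>u. (\<Sum>k<N. b (Y k \<omega>) * indicator {T k..<T (Suc k)} u) +
        b (Y N \<omega>) * indicator {T N..t} u \<partial>lborel)"
    by (simp add: set_lebesgue_integral_def)
  also have "\<dots> = (\<Sum>k<N. b (Y k \<omega>) * (T (Suc k) - T k)) + b (Y N \<omega>) * (t - T N)"
  proof (rule has_bochner_integral_integral_eq, intro has_bochner_integral_add
      has_bochner_integral_sum has_bochner_integral_mult_right)
    show "has_bochner_integral lborel (indicator {T k..<T (Suc k)}) (T (Suc k) - T k)" for k
      using has_bochner_integral_real_indicator[of "{T k..<T (Suc k)}" lborel] mono[of k "Suc k"]
      by simp
    show "has_bochner_integral lborel (indicator {T N..t}) (t - T N)"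
      using has_bochner_integral_real_indicator[of "{T N..t}" lborel] N by simp
  qed
  also have "\<dots> = additive_functional b t \<omega>"
    by (simp add: additive_functional_def N_def T_def jump_time_def)
  finally show ?thesis .
qed

lemma additive_functional_affine:
  "additive_functional (\<lambda>i. s * a i - r) t \<omega> = s * additive_functional a t \<omega> - r * t"
  by (simp add: additive_functional_def jump_time_def sum_subtractf sum_distrib_left
      algebra_simps)

lemma measurable_jumps [measurable]: "jumps t \<in> M \<rightarrow>\<^sub>M count_space UNIV"
  unfolding jumps_def[abs_def] jump_time_def by measurable

lemma measurable_additive_functional [measurable]: "additive_functional b t \<in> borel_measurable M"
proof -
  have [measurable]: "(\<lambda>\<omega>. b (Y k \<omega>)) \<in> borel_measurable M" for k
    by (rule measurable_compose[OF measurable_Y]) simp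
  have "(\<lambda>\<omega>. (\<Sum>k<n. b (Y k \<omega>) * S k \<omega>) + b (Y n \<omega>) * (t - jump_time n (\<lambda>k. S k \<omega>)))
      \<in> borel_measurable M" for n
    unfolding jump_time_def by measurable
  from measurable_compose_countable[OF this measurable_jumps]
  show ?thesis unfolding additive_functional_def[abs_def] .
qed

lemma measurable_X [measurable]:
  assumes "0 \<le> t"
  shows "X t \<in> M \<rightarrow>\<^sub>M count_space UNIV"
proof -
  have "(\<lambda>\<omega>. Y (jumps t \<omega>) \<omega>) \<in> M \<rightarrow>\<^sub>M count_space UNIV"
    by (rule measurable_compose_countable[OF measurable_Y measurable_jumps])
  then show ?thesis
    using measurable_cong[of M "X t" "\<lambda>\<omega>. Y (jumps t \<omega>) \<omega>"] jumps_bounds(3)[OF _ assms] by blast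
qed

text \<open>
  The Feynman-Kac formula for a solution \<open>v\<close> of \<open>(G + b) v = 0\<close>.  Let \<open>Z n\<close> be the
  weighted value of \<open>v\<close> at time \<open>t\<close> or at the \<open>n\<close>-th jump, whichever comes first.  Its expectation
  does not depend on \<open>n\<close> by the one-step identity, and it is bounded; since only finitely many
  jumps occur by time \<open>t\<close>, it eventually equals the weighted value at time \<open>t\<close>.
\<close>

lemma feynman_kac:
  fixes b v :: "'n \<Rightarrow> real"
  assumes t: "0 \<le> t"
    and v: "\<And>i. lam i * (\<Sum>j\<in>UNIV. q $ i $ j * v j) = (lam i - b i) * v i"
  shows "(\<integral>\<omega>. indicator {\<omega>\<in>space M. Y 0 \<omega> = i} \<omega> *
      (exp (additive_functional b t \<omega>) * v (X t \<omega>)) \<partial>M) = prob {\<omega>\<in>space M. Y 0 \<omega> = i} * v i"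
proof -
  obtain C where C: "\<And>n y s. \<bar>weight_at_jump b v t n y s\<bar> \<le> C"
    "\<And>n y s. \<bar>final_weight b v t n y s\<bar> \<le> C"
    using weights_bounded[OF t] by metis
  define A where "A = {\<omega>\<in>space M. Y 0 \<omega> = i}"
  have A [measurable]: "A \<in> events" unfolding A_def by measurable
  define W where "W n \<omega> = weight_at_jump b v t n (\<lambda>k. Y k \<omega>) (\<lambda>k. S k \<omega>)" for n \<omega>
  define F where "F n \<omega> = final_weight b v t n (\<lambda>k. Y k \<omega>) (\<lambda>k. S k \<omega>)" for n \<omega>
  define Z where "Z n \<omega> = (\<Sum>m<n. F m \<omega>) + W n \<omega>" for n \<omega>
  let ?f = "\<lambda>\<omega>. exp (additive_functional b t \<omega>) * v (X t \<omega>)"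
  have [measurable]: "W n \<in> borel_measurable M" "F n \<in> borel_measurable M" for n
    unfolding W_def[abs_def] F_def[abs_def] by measurable
  have [measurable]: "Z n \<in> borel_measurable M" for n
    unfolding Z_def[abs_def] by measurable
  have W_int: "integrable M (W n)" and F_int: "integrable M (F n)" for n
    using C by (auto intro!: integrable_const_bound[of _ C] simp: W_def F_def)
  have Z_eq: "Z n \<omega> = (if n \<le> jumps t \<omega> then W n \<omega> else F (jumps t \<omega>) \<omega>)"
    and F_eq: "F (jumps t \<omega>) \<omega> = ?f \<omega>" if \<omega>: "\<omega> \<in> space M" for n \<omega>
  proof -
    have F: "F m \<omega> = (if m = jumps t \<omega> then F (jumps t \<omega>) \<omega> else 0)" for m
      using final_weight_eq[OF \<omega> t] by (simp add: F_def)
    have "(\<Sum>m<n. F m \<omega>) = (\<Sum>m<n. if m = jumps t \<omega> then F (jumps t \<omega>) \<omega> else 0)"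
      by (rule sum.cong[OF refl F])
    also have "\<dots> = (if jumps t \<omega> < n then F (jumps t \<omega>) \<omega> else 0)" by simp
    finally show "Z n \<omega> = (if n \<le> jumps t \<omega> then W n \<omega> else F (jumps t \<omega>) \<omega>)"
      using reaches_iff[OF \<omega> t, of n] by (auto simp: Z_def W_def weight_at_jump_def)
    show "F (jumps t \<omega>) \<omega> = ?f \<omega>"
      using final_weight_eq[OF \<omega> t] by (simp add: F_def)
  qed
  have Z_bound: "\<bar>Z n \<omega>\<bar> \<le> C" if "\<omega> \<in> space M" for n \<omega>
    using C by (simp add: Z_eq[OF that] W_def F_def)
  have Z_lim: "(\<lambda>n. Z n \<omega>) \<longlonglongrightarrow> ?f \<omega>" if "\<omega> \<in> space M" for \<omega>
  proof (rule tendsto_eventually)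
    show "\<forall>\<^sub>F n in sequentially. Z n \<omega> = ?f \<omega>"
      using eventually_gt_at_top[of "jumps t \<omega>"]
      by eventually_elim (simp only: Z_eq[OF that] F_eq[OF that] not_le[symmetric] if_False)
  qed
  have Z_int: "integrable M (Z n)" for n
    unfolding Z_def[abs_def] using W_int F_int by auto
  have AZ_int: "integrable M (\<lambda>\<omega>. indicator A \<omega> * Z n \<omega>)" for n
    using integrable_mult_indicator[OF A Z_int] by simp
  have const: "(\<integral>\<omega>. indicator A \<omega> * Z n \<omega> \<partial>M) = prob A * v i" for n
  proof (induction n)
    case 0
    have "(\<integral>\<omega>. indicator A \<omega> * Z 0 \<omega> \<partial>M) = (\<integral>\<omega>. indicator A \<omega> * v i \<partial>M)"
    proof (intro Bochner_Integration.integral_cong refl)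
      show "indicator A \<omega> * Z 0 \<omega> = indicator A \<omega> * v i" for \<omega>
        using t by (auto simp: Z_def W_def weight_at_jump_def reaches_def jump_time_def A_def
            split: split_indicator)
    qed
    then show ?case using A by simp
  next
    case (Suc n)
    have h_int: "integrable M (\<lambda>\<omega>. W n \<omega> - F n \<omega> - W (Suc n) \<omega>)"
      using W_int F_int by auto
    have "(\<integral>\<omega>. indicator A \<omega> * Z n \<omega> \<partial>M) - (\<integral>\<omega>. indicator A \<omega> * Z (Suc n) \<omega> \<partial>M) =
        (\<integral>\<omega>. indicator A \<omega> * Z n \<omega> - indicator A \<omega> * Z (Suc n) \<omega> \<partial>M)"
      using AZ_int by (simp only: Bochner_Integration.integral_diff)
    also have "\<dots> = (\<integral>\<omega>. indicator A \<omega> * (W n \<omega> - F n \<omega> - W (Suc n) \<omega>) \<partial>M)"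
      by (simp add: Z_def algebra_simps)
    also have "\<dots> = 0"
      unfolding A_def
      by (rule integral_initial_state_zero[OF h_int, of n])
        (unfold W_def F_def, rule weights_one_step_on_path[OF t v])
    finally show ?case using Suc by simp
  qed
  have "(\<lambda>n. \<integral>\<omega>. indicator A \<omega> * Z n \<omega> \<partial>M) \<longlonglongrightarrow> (\<integral>\<omega>. indicator A \<omega> * ?f \<omega> \<partial>M)"
  proof (rule integral_dominated_convergence[where w = "\<lambda>_. C"])
    have [measurable]: "(\<lambda>\<omega>. v (X t \<omega>)) \<in> borel_measurable M"
      by (rule measurable_compose[OF measurable_X[OF t]]) simp
    show "(\<lambda>\<omega>. indicator A \<omega> * ?f \<omega>) \<in> borel_measurable M" by measurable
    show "AE \<omega> in M. (\<lambda>n. indicator A \<omega> * Z n \<omega>) \<longlonglongrightarrow> indicator A \<omega> * ?f \<omega>"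
      using Z_lim by (auto intro!: tendsto_mult AE_I2)
    show "AE \<omega> in M. norm (indicator A \<omega> * Z n \<omega>) \<le> C" for n
    proof (rule AE_I2)
      fix \<omega> assume "\<omega> \<in> space M"
      then show "norm (indicator A \<omega> * Z n \<omega>) \<le> C"
        using Z_bound[of \<omega> n] by (auto split: split_indicator)
    qed
  qed auto
  then have "(\<lambda>n. prob A * v i) \<longlonglongrightarrow> (\<integral>\<omega>. indicator A \<omega> * ?f \<omega> \<partial>M)"
    unfolding const .
  then have "prob A * v i = (\<integral>\<omega>. indicator A \<omega> * ?f \<omega> \<partial>M)"
    by (rule LIMSEQ_unique[OF tendsto_const])
  then show ?thesis unfolding A_def by (rule sym)
qed

lemma expect_from_eq:
  assumes "Z \<in> borel_measurable M" and "prob {\<omega>\<in>space M. Y 0 \<omega> = i} \<noteq> 0"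
  shows "expect_from M X i Z =
    (\<integral>\<omega>. indicator {\<omega>\<in>space M. Y 0 \<omega> = i} \<omega> * Z \<omega> \<partial>M) / prob {\<omega>\<in>space M. Y 0 \<omega> = i}"
proof -
  have "{\<omega>\<in>space M. X 0 \<omega> = i} = {\<omega>\<in>space M. Y 0 \<omega> = i}"
    using initial_state by auto
  moreover have "{\<omega>\<in>space M. Y 0 \<omega> = i} \<in> events" by measurable
  ultimately show ?thesis
    unfolding expect_from_def using assms
    by (simp add: integral_uniform_measure emeasure_eq_measure)
qed

text \<open>
  The positive eigenvector of the tilted generator is also an eigenvector of \<open>A_matrix\<close>: apply
  the Feynman-Kac formula to the potential \<open>s a - r\<close>, where \<open>r\<close> is the growth rate, and take the
  constant factor \<open>exp (r * t)\<close> out of the expectation.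
\<close>

lemma A_matrix_spectral_radius:
  assumes t: "0 \<le> t" and init: "\<And>i. prob {\<omega>\<in>space M. X 0 \<omega> = i} > 0"
  shows "spectral_radius (A_matrix M X a s t) = exp (growth_rate (\<lambda>i. s * a i) * t)"
proof -
  define r where "r = growth_rate (\<lambda>i. s * a i)"
  obtain v where v: "\<And>i. 0 < v $ i"
    "\<And>i. lam i * (\<Sum>j\<in>UNIV. q $ i $ j * v $ j) = (lam i - s * a i + r) * v $ i"
    using growth_rate_eigenvector[of "\<lambda>i. s * a i"] unfolding r_def by metis
  define E where "E \<omega> = exp (s * additive_functional a t \<omega>)" for \<omega>
  define A where "A i = {\<omega>\<in>space M. Y 0 \<omega> = i}" for i
  have A [measurable]: "A i \<in> events" for i unfolding A_def by measurable
  have "A i = {\<omega>\<in>space M. X 0 \<omega> = i}" for i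
    using initial_state by (auto simp: A_def)
  then have A_pos: "0 < prob (A i)" for i using init by simp
  have [measurable]: "E \<in> borel_measurable M" unfolding E_def[abs_def] by measurable
  have [measurable]: "X t \<in> M \<rightarrow>\<^sub>M count_space UNIV" by (rule measurable_X[OF t])
  have powr: "Phi1 X a t \<omega> powr s = E \<omega>" if "\<omega> \<in> space M" for \<omega>
    using integral_along_path[OF that t, of a] by (simp add: Phi1_def E_def powr_def)
  have entry: "A_matrix M X a s t $ i $ j =
      (\<integral>\<omega>. indicator (A i) \<omega> * (E \<omega> * indicator {j} (X t \<omega>)) \<partial>M) / prob (A i)" for i j
  proof -
    let ?Z = "\<lambda>\<omega>. Phi1 X a t \<omega> powr s * (if X t \<omega> = j then 1 else 0)"
    have Z: "?Z \<omega> = E \<omega> * indicator {j} (X t \<omega>)" if "\<omega> \<in> space M" for \<omega>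
      using powr[OF that] by simp
    have "(\<lambda>\<omega>. E \<omega> * indicator {j} (X t \<omega>)) \<in> borel_measurable M" by measurable
    then have "?Z \<in> borel_measurable M"
      using measurable_cong[of M ?Z, OF Z] by blast
    then have "A_matrix M X a s t $ i $ j = (\<integral>\<omega>. indicator (A i) \<omega> * ?Z \<omega> \<partial>M) / prob (A i)"
      using A_pos[of i] by (simp add: A_matrix_def expect_from_eq A_def)
    also have "(\<integral>\<omega>. indicator (A i) \<omega> * ?Z \<omega> \<partial>M) =
        (\<integral>\<omega>. indicator (A i) \<omega> * (E \<omega> * indicator {j} (X t \<omega>)) \<partial>M)"
      by (intro Bochner_Integration.integral_cong refl) (simp only: Z)
    finally show ?thesis .
  qed
  have entry_int: "integrable M (\<lambda>\<omega>. indicator (A i) \<omega> * (E \<omega> * indicator {j} (X t \<omega>)))" for i j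
  proof -
    obtain C where C: "\<And>n y s'. \<bar>final_weight (\<lambda>i. s * a i) (\<lambda>_. 1) t n (y :: nat \<Rightarrow> 'n) s'\<bar> \<le> C"
      using weights_bounded[OF t] by metis
    have "\<bar>E \<omega>\<bar> \<le> C" if "\<omega> \<in> space M" for \<omega>
      using C[of "jumps t \<omega>" "\<lambda>k. Y k \<omega>" "\<lambda>k. S k \<omega>"] final_weight_eq[OF that t]
        additive_functional_affine[of s a 0] by (simp add: E_def)
    then have "norm (indicator (A i) \<omega> * (E \<omega> * indicator {j} (X t \<omega>))) \<le> C"
      if "\<omega> \<in> space M" for \<omega>
      using that abs_ge_zero[of "E \<omega>"]
      by (force split: split_indicator intro: order_trans)
    then show ?thesis
      by (intro integrable_const_bound[of _ C]) (auto intro!: AE_I2)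
  qed
  have eigen: "A_matrix M X a s t *v v = exp (r * t) *s v"
  proof (rule vec_eq_iff[THEN iffD2, rule_format])
    fix i
    have "(A_matrix M X a s t *v v) $ i =
        (\<Sum>j\<in>UNIV. (\<integral>\<omega>. indicator (A i) \<omega> * (E \<omega> * indicator {j} (X t \<omega>)) * v $ j \<partial>M)) / prob (A i)"
      by (simp add: matrix_vector_component entry sum_divide_distrib)
    also have "(\<Sum>j\<in>UNIV. (\<integral>\<omega>. indicator (A i) \<omega> * (E \<omega> * indicator {j} (X t \<omega>)) * v $ j \<partial>M)) =
        (\<integral>\<omega>. (\<Sum>j\<in>UNIV. indicator (A i) \<omega> * (E \<omega> * indicator {j} (X t \<omega>)) * v $ j) \<partial>M)"
      by (intro Bochner_Integration.integral_sum[symmetric] integrable_mult_left entry_int)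
    also have "\<dots> = (\<integral>\<omega>. exp (r * t) * (indicator (A i) \<omega> *
        (exp (additive_functional (\<lambda>i. s * a i - r) t \<omega>) * v $ X t \<omega>)) \<partial>M)"
    proof (intro Bochner_Integration.integral_cong refl)
      fix \<omega> assume \<omega>: "\<omega> \<in> space M"
      have "(\<Sum>j\<in>UNIV. indicator (A i) \<omega> * (E \<omega> * indicator {j} (X t \<omega>)) * v $ j) =
          (\<Sum>j\<in>UNIV. if j = X t \<omega> then indicator (A i) \<omega> * E \<omega> * v $ j else 0)"
        by (rule sum.cong) (auto split: split_indicator)
      also have "\<dots> = indicator (A i) \<omega> * E \<omega> * v $ X t \<omega>" by simp
      also have "\<dots> = exp (r * t) * (indicator (A i) \<omega> *
          (exp (additive_functional (\<lambda>i. s * a i - r) t \<omega>) * v $ X t \<omega>))"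
      proof -
        have "E \<omega> = exp (r * t) * exp (additive_functional (\<lambda>i. s * a i - r) t \<omega>)"
          by (simp add: E_def additive_functional_affine flip: exp_add)
        then show ?thesis by simp
      qed
      finally show "(\<Sum>j\<in>UNIV. indicator (A i) \<omega> * (E \<omega> * indicator {j} (X t \<omega>)) * v $ j) =
          exp (r * t) * (indicator (A i) \<omega> *
          (exp (additive_functional (\<lambda>i. s * a i - r) t \<omega>) * v $ X t \<omega>))" .
    qed
    also have "\<dots> = exp (r * t) * (prob (A i) * v $ i)"
    proof -
      have "lam i * (\<Sum>j\<in>UNIV. q $ i $ j * v $ j) = (lam i - (s * a i - r)) * v $ i" for i
        unfolding v(2) by (simp add: algebra_simps)
      from feynman_kac[OF t this] show ?thesis by (simp add: A_def)
    qed
    finally show "(A_matrix M X a s t *v v) $ i = (exp (r * t) *s v) $ i"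
      using A_pos[of i] by simp
  qed
  have "spectral_radius (A_matrix M X a s t) = exp (r * t)"
  proof (rule spectral_radius_eq_positive_eigenvalue[OF _ v(1) eigen])
    show "0 \<le> A_matrix M X a s t $ i $ j" for i j
      unfolding entry by (intro divide_nonneg_nonneg integral_nonneg) (auto simp: E_def)
  qed
  then show ?thesis by (simp add: r_def)
qed

end

section \<open>Both spectral conditions say that the growth rate vanishes\<close>

lemma (in jump_rates) jump_construction_exists:
  assumes "markov_jump_process M lam q X"
  obtains Y S where "jump_construction lam q M X Y S"
proof -
  show thesis
    using assms unfolding markov_jump_process_def
  proof (elim conjE exE, goal_cases)
    case (1 Y S)
    then have "jump_construction_axioms lam q M X Y S"
      by (intro jump_construction_axioms.intro) simp_all
    with 1(1) show ?case
      by (intro that[of Y S] jump_construction.intro jump_rates_axioms)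
  qed
qed

theorem corollary4:
  fixes M :: "'w measure"
    and X :: "real \<Rightarrow> 'w \<Rightarrow> 'n::finite"
    and lam a \<mu> :: "'n \<Rightarrow> real"
    and q :: "real ^ 'n ^ 'n"
    and \<delta> :: real
  assumes "CARD('n) > 1"
    and "\<And>i. lam i > 0"
    and "stochastic_matrix q"
    and "irreducible_matrix q"
    and "\<And>i. q $ i $ i = 0"
    and "markov_jump_process M lam q X"
    and "invariant_probability lam q \<mu>"
    and "stationary_process M X"
    and "\<And>i. measure M {\<omega>\<in>space M. X 0 \<omega> = i} = \<mu> i"
    and "(\<Sum>i\<in>UNIV. a i * \<mu> i) < 0"
    and "\<exists>i. a i > 0"
    and "\<delta> > 0"
  shows "(\<exists>!s. 0 < s \<and> s < s1 lam a \<and> spectral_radius (M_matrix lam q a s) = 1) \<and>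
    (\<exists>!\<kappa>. 0 < \<kappa> \<and> spectral_radius (A_matrix M X a \<kappa> \<delta>) = 1) \<and>
    (THE s. 0 < s \<and> s < s1 lam a \<and> spectral_radius (M_matrix lam q a s) = 1) =
    (THE \<kappa>. 0 < \<kappa> \<and> spectral_radius (A_matrix M X a \<kappa> \<delta>) = 1)"
proof -
  interpret jump_rates lam q
    by unfold_locales (use assms in auto)
  obtain k where k: "0 < a k" using assms(11) ..
  let ?P = "\<lambda>s. 0 < s \<and> growth_rate (\<lambda>i. s * a i) = 0"
  have M: "0 < s \<and> s < s1 lam a \<and> spectral_radius (M_matrix lam q a s) = 1 \<longleftrightarrow> ?P s" for s
    using M_matrix_radius_one_iff[of a k s, OF k] by blast
  have A: "0 < s \<and> spectral_radius (A_matrix M X a s \<delta>) = 1 \<longleftrightarrow> ?P s" for s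
  proof -
    obtain Y S where "jump_construction lam q M X Y S"
      using jump_construction_exists[OF assms(6)] .
    then interpret jump_construction lam q M X Y S .
    have "spectral_radius (A_matrix M X a s \<delta>) = exp (growth_rate (\<lambda>i. s * a i) * \<delta>)"
      using assms(12) invariant_probability_pos[OF assms(7)]
      by (intro A_matrix_spectral_radius) (simp_all add: assms(9))
    then show ?thesis using assms(12) by simp
  qed
  show ?thesis
    unfolding M A using growth_rate_unique_zero[of \<mu> a k, OF assms(7,10) k] by simp
qed

end
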